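(* Let $z,w\in\mathbb{C}^\times$ with $|z|<c_1|w|$, where $c_1=\min(1,|v|^{-1-1/n})$. Then, on each $\mathfrak{F}_m$ (as an identity of matrix coefficients), $$T_\Delta(z)T_\Gamma(w)=\frac{(1-vz^nw^{-n})(1-v^nz^nw^{-n})}{(1-z^nw^{-n})(1-v^{n+1}z^nw^{-n})}\,T_\Gamma(w)T_\Delta(z).$$
   Context: Fix an integer $n\ge1$, $v\in\mathbb{C}^\times$ not a root of unity, and $g:\mathbb{Z}/n\mathbb{Z}\to\mathbb{C}$ with $g(0)=-v$ and $g(a)g(-a)=v$ for $a\not\equiv0$ mod $n$. For $m\in\mathbb{Z}$, $\mathfrak{F}_m$ is the complex vector space with basis the vectors $u_{\mathbf{i}}=u_{i_m}\wedge u_{i_{m-1}}\wedge\cdots$ indexed by strictly decreasing integer sequences $\mathbf{i}=(i_m,i_{m-1},\dots)$ with $i_k=k$ for $k\ll0$. The degree of $u_{\mathbf{i}}$ is $\sum_{k\le m}(i_k-k)$. Ice. Consider one row of vertices, one in each column, columns labeled by all integers in decreasing order from left to right; the right edge of a vertex is the left edge of the next. Vertical edges carry spins $\pm$, horizontal edges decorated spins $\pm^a$, $a\in\mathbb{Z}/n\mathbb{Z}$. For $\xi=u_{\mathbf{i}}$, $\eta=u_{\mathbf{j}}$ the top edges are $-$ exactly in columns $i_m,i_{m-1},\dots$ and the bottom edges are $-$ exactly in columns $j_m,j_{m-1},\dots$. A state assigns decorated spins to horizontal edges, all but finitely many being $+^0$ (Delta), resp. $-^0$ (Gamma); it is admissible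 if every vertex has one of the configurations (left, top, right, bottom) below, with the given weight. Delta: $(+^0,+,+^0,+)$: $1$; $(-^a,-,-^{a+1},-)$: $g(a)z$; $(+^0,-,+^0,-)$: $1$; $(-^a,+,-^{a+1},+)$: $z$; $(-^0,+,+^0,-)$: $(1-v)z$; $(+^0,-,-^1,+)$: $1$. Gamma: $(+^{a+1},+,+^a,+)$: $z^{-1}$; $(-^0,-,-^0,-)$: $1$; $(+^{a+1},-,+^a,-)$: $z^{-1}g(a)$; $(-^0,+,-^0,+)$: $1$; $(-^0,+,+^0,-)$: $1-v$; $(+^1,-,-^0,+)$: $z^{-1}$. $\langle\eta|T_\Delta(z)|\xi\rangle$ and $\langle\eta|T_\Gamma(z)|\xi\rangle$ are the sums over admissible states of the products of vertex weights. Products are defined through matrix coefficients: $\langle\eta|AB|\xi\rangle=\sum_\zeta\langle\eta|A|\zeta\rangle\langle\zeta|B|\xi\rangle$, $\zeta$ running over basis vectors. For $T_\Gamma(w)T_\Delta(z)$ this is a finite sum; for $T_\Delta(z)T_\Gamma(w)$ it is an infinite sum (finitely many $\zeta$ in each degree, summed in order of increasing degree), convergent when $|z|<c_1|w|$. *)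

theory Defs
  imports Complex_Main "HOL-Library.FuncSet"
begin

section \<open>Fock space\<close>

text \<open>The space of charge \<open>m\<close> enters only through its basis: the index sequence
  \<open>(i_m, i_{m-1}, \<dots>)\<close> is the function \<open>k \<mapsto> i_k\<close> on \<open>{..m}\<close>, which is strictly increasing in the
  index \<open>k\<close>. It is \<open>undefined\<close> off \<open>{..m}\<close>, so that distinct functions are distinct basis vectors.\<close>

definition fock_basis :: "int \<Rightarrow> (int \<Rightarrow> int) set" where
  "fock_basis m = {i \<in> extensional {..m}. strict_mono_on {..m} i \<and> (\<forall>\<^sub>F k in at_bot. i k = k)}"

definition fock_degree :: "int \<Rightarrow> (int \<Rightarrow> int) \<Rightarrow> int" where
  "fock_degree m i = (\<Sum>k | k \<le> m \<and> i k \<noteq> k. i k - k)"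

text \<open>An operator is given by its matrix coefficients: \<open>A \<eta> \<zeta>\<close> is \<open>\<langle>\<eta>|A|\<zeta>\<rangle>\<close>. In a product the
  intermediate basis vectors, finitely many in each degree, are summed in order of increasing
  degree.\<close>

definition prod_degree_term ::
  "int \<Rightarrow> ((int \<Rightarrow> int) \<Rightarrow> (int \<Rightarrow> int) \<Rightarrow> complex) \<Rightarrow> ((int \<Rightarrow> int) \<Rightarrow> (int \<Rightarrow> int) \<Rightarrow> complex) \<Rightarrow>
    (int \<Rightarrow> int) \<Rightarrow> (int \<Rightarrow> int) \<Rightarrow> nat \<Rightarrow> complex" where
  "prod_degree_term m A B \<eta> \<xi> d =
    (\<Sum>\<zeta> | \<zeta> \<in> fock_basis m \<and> fock_degree m \<zeta> = int d. A \<eta> \<zeta> * B \<zeta> \<xi>)"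

definition op_prod ::
  "int \<Rightarrow> ((int \<Rightarrow> int) \<Rightarrow> (int \<Rightarrow> int) \<Rightarrow> complex) \<Rightarrow> ((int \<Rightarrow> int) \<Rightarrow> (int \<Rightarrow> int) \<Rightarrow> complex) \<Rightarrow>
    (int \<Rightarrow> int) \<Rightarrow> (int \<Rightarrow> int) \<Rightarrow> complex" where
  "op_prod m A B \<eta> \<xi> = (\<Sum>d. prod_degree_term m A B \<eta> \<xi> d)"

section \<open>Delta and Gamma ice\<close>

text \<open>Residue classes modulo \<open>n\<close> are represented by integers in \<open>{0..<int n}\<close>; the decorated spin
  \<open>\<plusminus>\<^sup>a\<close> is the pair of the spin and the representative of \<open>a\<close>.\<close>

datatype spin = SPlus | SMinus

type_synonym dspin = "spin \<times> int"

type_synonym vertex_weight = "dspin \<Rightarrow> spin \<Rightarrow> dspin \<Rightarrow> spin \<Rightarrow> complex option"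

text \<open>The edges around a vertex are listed as left, top, right, bottom; \<open>None\<close> marks the
  configurations that are not admissible.\<close>

fun delta_weight :: "nat \<Rightarrow> complex \<Rightarrow> (int \<Rightarrow> complex) \<Rightarrow> complex \<Rightarrow> vertex_weight" where
  "delta_weight n v g z (SPlus, a) SPlus (SPlus, b) SPlus =
     (if a = 0 \<and> b = 0 then Some 1 else None)"
| "delta_weight n v g z (SMinus, a) SMinus (SMinus, b) SMinus =
     (if b = (a + 1) mod int n then Some (g a * z) else None)"
| "delta_weight n v g z (SPlus, a) SMinus (SPlus, b) SMinus =
     (if a = 0 \<and> b = 0 then Some 1 else None)"
| "delta_weight n v g z (SMinus, a) SPlus (SMinus, b) SPlus =
     (if b = (a + 1) mod int n then Some z else None)"
| "delta_weight n v g z (SMinus, a) SPlus (SPlus, b) SMinus =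
     (if a = 0 \<and> b = 0 then Some ((1 - v) * z) else None)"
| "delta_weight n v g z (SPlus, a) SMinus (SMinus, b) SPlus =
     (if a = 0 \<and> b = 1 mod int n then Some 1 else None)"
| "delta_weight n v g z _ _ _ _ = None"

text \<open>In the first and third Gamma configurations the right edge carries \<open>b\<close> and the left edge
  \<open>b + 1\<close>.\<close>

fun gamma_weight :: "nat \<Rightarrow> complex \<Rightarrow> (int \<Rightarrow> complex) \<Rightarrow> complex \<Rightarrow> vertex_weight" where
  "gamma_weight n v g z (SPlus, a) SPlus (SPlus, b) SPlus =
     (if a = (b + 1) mod int n then Some (inverse z) else None)"
| "gamma_weight n v g z (SMinus, a) SMinus (SMinus, b) SMinus =
     (if a = 0 \<and> b = 0 then Some 1 else None)"
| "gamma_weight n v g z (SPlus, a) SMinus (SPlus, b) SMinus =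
     (if a = (b + 1) mod int n then Some (inverse z * g b) else None)"
| "gamma_weight n v g z (SMinus, a) SPlus (SMinus, b) SPlus =
     (if a = 0 \<and> b = 0 then Some 1 else None)"
| "gamma_weight n v g z (SMinus, a) SPlus (SPlus, b) SMinus =
     (if a = 0 \<and> b = 0 then Some (1 - v) else None)"
| "gamma_weight n v g z (SPlus, a) SMinus (SMinus, b) SPlus =
     (if a = 1 mod int n \<and> b = 0 then Some (inverse z) else None)"
| "gamma_weight n v g z _ _ _ _ = None"

definition column_spin :: "int \<Rightarrow> (int \<Rightarrow> int) \<Rightarrow> int \<Rightarrow> spin" where
  "column_spin m i c = (if c \<in> i ` {..m} then SMinus else SPlus)"

text \<open>In a state \<open>s\<close>, \<open>s c\<close> is the left edge of the vertex in column \<open>c\<close>. Columns decrease from left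
  to right, so its right edge is \<open>s (c - 1)\<close>. The top edges come from \<open>\<xi>\<close>, the bottom edges
  from \<open>\<eta>\<close>, and \<open>e\<close> is the decorated spin of all but finitely many horizontal edges.\<close>

definition vertex_at ::
  "vertex_weight \<Rightarrow> int \<Rightarrow> (int \<Rightarrow> int) \<Rightarrow> (int \<Rightarrow> int) \<Rightarrow> (int \<Rightarrow> dspin) \<Rightarrow> int \<Rightarrow> complex option" where
  "vertex_at W m \<eta> \<xi> s c = W (s c) (column_spin m \<xi> c) (s (c - 1)) (column_spin m \<eta> c)"

definition admissible_states ::
  "nat \<Rightarrow> vertex_weight \<Rightarrow> dspin \<Rightarrow> int \<Rightarrow> (int \<Rightarrow> int) \<Rightarrow> (int \<Rightarrow> int) \<Rightarrow> (int \<Rightarrow> dspin) set" where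
  "admissible_states n W e m \<eta> \<xi> =
    {s. (\<forall>c. snd (s c) \<in> {0..<int n}) \<and> finite {c. s c \<noteq> e} \<and> (\<forall>c. vertex_at W m \<eta> \<xi> s c \<noteq> None)}"

text \<open>All but finitely many vertices of an admissible state have both horizontal edges equal to
  \<open>e\<close>, hence weight 1 in both models, so the product over weights other than 1 is finite. For given boundary
  spins there is at most one admissible state, because each vertex determines its right edge
  from the other three.\<close>

definition row_coeff ::
  "nat \<Rightarrow> vertex_weight \<Rightarrow> dspin \<Rightarrow> int \<Rightarrow> (int \<Rightarrow> int) \<Rightarrow> (int \<Rightarrow> int) \<Rightarrow> complex" where
  "row_coeff n W e m \<eta> \<xi> =
    (\<Sum>s\<in>admissible_states n W e m \<eta> \<xi>.
       \<Prod>c | the (vertex_at W m \<eta> \<xi> s c) \<noteq> 1. the (vertex_at W m \<eta> \<xi> s c))"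

definition T_Delta ::
  "nat \<Rightarrow> complex \<Rightarrow> (int \<Rightarrow> complex) \<Rightarrow> int \<Rightarrow> complex \<Rightarrow> (int \<Rightarrow> int) \<Rightarrow> (int \<Rightarrow> int) \<Rightarrow> complex" where
  "T_Delta n v g m z = row_coeff n (delta_weight n v g z) (SPlus, 0) m"

definition T_Gamma ::
  "nat \<Rightarrow> complex \<Rightarrow> (int \<Rightarrow> complex) \<Rightarrow> int \<Rightarrow> complex \<Rightarrow> (int \<Rightarrow> int) \<Rightarrow> (int \<Rightarrow> int) \<Rightarrow> complex" where
  "T_Gamma n v g m z = row_coeff n (gamma_weight n v g z) (SMinus, 0) m"

end

theory Submission
  imports Defs "HOL-Analysis.Elementary_Normed_Spaces" "HOL-Analysis.Infinite_Sum"
begin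

text \<open>
  Stack the two rows and read the pair of horizontal edges as the state of a transfer process that
  runs through the columns. With \<open>x = z / w\<close>, an R-matrix \<open>X\<close> that does not depend on the column
  intertwines the step with Gamma ice on top and the step with Delta ice on top, for each choice of
  the outer vertical spins. In \<open>T_Gamma(w) T_Delta(z)\<close> the state is the vacuum \<open>(+\<^sup>0, -\<^sup>0)\<close> far to
  the left and far to the right. In \<open>T_Delta(z) T_Gamma(w)\<close> infinitely many intermediate vectors
  come from a pair of opposite edges running out to infinity on either side: on the left this
  sums to the row \<open>e X / (1 - x^n)\<close>, where \<open>e\<close> is the vacuum, and on the right to a column \<open>r\<close>. The
  train argument moves \<open>X\<close> through the strip, and \<open>X r\<close> is the vacuum times
  \<open>(1 - v x^n) (1 - v^n x^n) / (1 - v^(n+1) x^n)\<close>.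
\<close>

section \<open>Transfer steps in decorated labels\<close>

text \<open>The train argument computes limits along growing windows of columns, whereas the product
  sums the intermediate vectors by degree. Two such orders can be exchanged under absolute
  convergence, so a bound on the sums of absolute values is needed as well. It comes from the same
  machinery run on nonnegative weights, with \<open>norm (1 - v)\<close> for \<open>1 - v\<close>
  and \<open>norm (g a)\<close> for \<open>g a\<close>. This destroys \<open>g 0 = - v\<close> and
  the link between the factor \<open>1 - v\<close> and the products \<open>g a * g (- a)\<close>.
  Hence the locale keeps \<open>v\<close>, met in \<open>1 - v\<close>, apart from \<open>u\<close>,
  the value of those products, and it fixes only the square of \<open>g 0\<close>. The analysis of
  both ends works at this generality; \<open>v = u\<close> and \<open>g 0 = - v\<close> are assumed
  later, for the exact evaluation. The two bounds in c_1 belong to the two ends. Among the empty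
  columns on the left a pair costs \<open>x\<close> per column, hence |x| < 1. Among the occupied
  columns on the right a lap of \<open>n\<close> columns costs \<open>u ^ (n + 1) * x ^ n\<close>,
  with one \<open>u\<close> from each label not divisible by \<open>n\<close> and
  \<open>u ^ 2\<close> from the remaining one, hence |v|^(n+1) |x|^n < 1.\<close>

definition edge_states :: "nat \<Rightarrow> dspin set" where
  "edge_states n = {SPlus, SMinus} \<times> {0..<int n}"

definition weight_val :: "vertex_weight \<Rightarrow> dspin \<Rightarrow> spin \<Rightarrow> dspin \<Rightarrow> spin \<Rightarrow> complex" where
  "weight_val W l t r b = (case W l t r b of None \<Rightarrow> 0 | Some y \<Rightarrow> y)"

text \<open>\<open>H\<close> lives on the right edge and the result on the left edge, so iterating
  the step adds columns on the left.\<close>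

definition row_step ::
  "nat \<Rightarrow> vertex_weight \<Rightarrow> spin \<Rightarrow> spin \<Rightarrow> (dspin \<Rightarrow> complex) \<Rightarrow> dspin \<Rightarrow> complex" where
  "row_step n W t b H p = (\<Sum>q\<in>edge_states n. weight_val W p t q b * H q)"

definition pair_step ::
  "nat \<Rightarrow> vertex_weight \<Rightarrow> vertex_weight \<Rightarrow> spin \<Rightarrow> spin \<Rightarrow>
    (dspin \<Rightarrow> dspin \<Rightarrow> complex) \<Rightarrow> dspin \<Rightarrow> dspin \<Rightarrow> complex" where
  "pair_step n W1 W2 t b F p1 p2 =
    (\<Sum>s\<in>{SPlus, SMinus}. row_step n W1 t s (\<lambda>q1. row_step n W2 s b (F q1) p2) p1)"

lemma finite_edge_states [simp]: "finite (edge_states n)"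
  by (simp add: edge_states_def)

lemma row_step_single:
  assumes "q0 \<in> edge_states n"
    and "\<And>q. q \<in> edge_states n \<Longrightarrow> q \<noteq> q0 \<Longrightarrow> weight_val W p t q b = 0"
  shows "row_step n W t b H p = weight_val W p t q0 b * H q0"
proof -
  have "row_step n W t b H p = (\<Sum>q\<in>{q0}. weight_val W p t q b * H q)"
    unfolding row_step_def using assms by (intro sum.mono_neutral_right) auto
  then show ?thesis by simp
qed

lemma row_step_zero:
  assumes "\<And>q. q \<in> edge_states n \<Longrightarrow> weight_val W p t q b = 0"
  shows "row_step n W t b H p = 0"
  unfolding row_step_def using assms by (simp add: sum.neutral)

locale ice_pair =
  fixes n :: nat and v u z w :: complex and g :: "int \<Rightarrow> complex"
  assumes n_pos: "n \<ge> 1"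
    and g_periodic: "\<And>a. g (a + int n) = g a"
    and g_zero: "g 0 ^ 2 = u ^ 2"
    and g_inv: "\<And>a. \<not> int n dvd a \<Longrightarrow> g a * g (- a) = u"
    and z_nonzero: "z \<noteq> 0" and w_nonzero: "w \<noteq> 0"
begin

definition x :: complex where "x = z / w"

abbreviation "delta \<equiv> delta_weight n v g z"
abbreviation "gamma \<equiv> gamma_weight n v g w"

text \<open>A Delta edge \<open>-\<^sup>k\<close> and a Gamma edge \<open>+\<^sup>1\<^sup>-\<^sup>k\<close> both carry the label \<open>k\<close>, which
  then increases by one modulo \<open>n\<close> at every step to the right in both rows.\<close>

definition dedge :: "int \<Rightarrow> dspin" where "dedge k = (SMinus, k mod int n)"
definition gedge :: "int \<Rightarrow> dspin" where "gedge k = (SPlus, (1 - k) mod int n)"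

abbreviation dvac :: dspin where "dvac \<equiv> (SPlus, 0)"
abbreviation gvac :: dspin where "gvac \<equiv> (SMinus, 0)"

lemma n_gt_0 [simp]: "n > 0"
  using n_pos by simp

lemma g_mult: "g (a + int n * int j) = g a"
proof (induction j)
  case (Suc j)
  have "a + int n * int (Suc j) = (a + int n * int j) + int n"
    by (simp add: algebra_simps)
  then have "g (a + int n * int (Suc j)) = g (a + int n * int j)"
    by (simp only: g_periodic)
  then show ?case using Suc.IH by simp
qed simp

lemma g_mod [simp]: "g (a mod int n) = g a"
proof (cases "a div int n \<ge> 0")
  case True
  have "g (a mod int n + int n * int (nat (a div int n))) = g (a mod int n)"
    by (rule g_mult)
  moreover have "a mod int n + int n * int (nat (a div int n)) = a" using True by simp
  ultimately show ?thesis by simp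
next
  case False
  have "g (a + int n * int (nat (- (a div int n)))) = g a" by (rule g_mult)
  moreover have "a + int n * int (nat (- (a div int n))) = a mod int n"
    using False minus_mult_div_eq_mod[of a "int n"] by simp
  ultimately show ?thesis by simp
qed

lemma g_cong: "a mod int n = b mod int n \<Longrightarrow> g a = g b"
  by (metis g_mod)

lemma states [simp]: "dvac \<in> edge_states n" "gvac \<in> edge_states n"
  "dedge k \<in> edge_states n" "gedge k \<in> edge_states n"
  using n_pos by (auto simp: edge_states_def dedge_def gedge_def)

section \<open>Vertex weights of single rows and stacked rows in terms of labels\<close>

lemma delta_steps:
  "row_step n delta SPlus SPlus H dvac = H dvac"
  "row_step n delta SMinus SMinus H dvac = H dvac"
  "row_step n delta SMinus SPlus H dvac = H (dedge 1)"
  "row_step n delta SPlus SMinus H dvac = 0"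
  "row_step n delta SPlus SPlus H (dedge k) = z * H (dedge (k + 1))"
  "row_step n delta SMinus SMinus H (dedge k) = g k * z * H (dedge (k + 1))"
  "row_step n delta SPlus SMinus H (dedge k) = (if int n dvd k then (1 - v) * z * H dvac else 0)"
  "row_step n delta SMinus SPlus H (dedge k) = 0"
proof -
  have A: "weight_val delta l t q b = 0" if "delta l t q b = None" for l t q b
    using that by (simp add: weight_val_def)
  have V: "weight_val delta dvac SPlus dvac SPlus = 1" "weight_val delta dvac SMinus dvac SMinus = 1"
    "weight_val delta dvac SMinus (dedge 1) SPlus = 1"
    "weight_val delta (dedge k) SPlus (dedge (k + 1)) SPlus = z"
    "weight_val delta (dedge k) SMinus (dedge (k + 1)) SMinus = g k * z"
    by (auto simp: weight_val_def dedge_def mod_simps)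
  show "row_step n delta SPlus SPlus H dvac = H dvac"
    by (subst row_step_single[of dvac]) (auto simp: V weight_val_def edge_states_def split: option.splits if_splits)
  show "row_step n delta SMinus SMinus H dvac = H dvac"
    by (subst row_step_single[of dvac]) (auto simp: V weight_val_def edge_states_def split: option.splits if_splits)
  show "row_step n delta SMinus SPlus H dvac = H (dedge 1)"
    by (subst row_step_single[of "dedge 1"]) (auto simp: V, auto simp: weight_val_def edge_states_def dedge_def split: option.splits if_splits)
  show "row_step n delta SPlus SMinus H dvac = 0"
    by (rule row_step_zero) (auto simp: weight_val_def edge_states_def)
  show "row_step n delta SPlus SPlus H (dedge k) = z * H (dedge (k + 1))"
    by (subst row_step_single[of "dedge (k + 1)"])
      (auto simp: V, auto simp: weight_val_def edge_states_def dedge_def mod_simps split: option.splits if_splits)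
  show "row_step n delta SMinus SMinus H (dedge k) = g k * z * H (dedge (k + 1))"
    by (subst row_step_single[of "dedge (k + 1)"])
      (auto simp: V, auto simp: weight_val_def edge_states_def dedge_def mod_simps split: option.splits if_splits)
  show "row_step n delta SPlus SMinus H (dedge k) = (if int n dvd k then (1 - v) * z * H dvac else 0)"
    by (subst row_step_single[of dvac])
      (auto simp: weight_val_def edge_states_def dedge_def mod_eq_0_iff_dvd split: option.splits if_splits)
  show "row_step n delta SMinus SPlus H (dedge k) = 0"
    by (rule row_step_zero) (auto simp: weight_val_def edge_states_def dedge_def)
qed

lemma gamma_label: "0 \<le> b \<Longrightarrow> b < int n \<Longrightarrow> (1 - k) mod int n = (b + 1) mod int n \<longleftrightarrow> b = (1 - (k + 1)) mod int n"
proof -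
  assume b: "0 \<le> b" "b < int n"
  have "(1 - k) mod int n = (b + 1) mod int n \<longleftrightarrow> int n dvd ((1 - k) - (b + 1))"
    by (simp add: mod_eq_dvd_iff)
  also have "\<dots> \<longleftrightarrow> (- k) mod int n = b mod int n" by (simp add: mod_eq_dvd_iff)
  also have "\<dots> \<longleftrightarrow> b = (- k) mod int n" using b by auto
  finally show ?thesis by simp
qed

lemma gamma_pick: "(1 - k) mod int n = 1 mod int n \<longleftrightarrow> int n dvd k"
  by (simp add: mod_eq_dvd_iff)

lemma gamma_steps:
  "row_step n gamma SPlus SPlus H gvac = H gvac"
  "row_step n gamma SMinus SMinus H gvac = H gvac"
  "row_step n gamma SPlus SMinus H gvac = (1 - v) * H (gedge 1)"
  "row_step n gamma SMinus SPlus H gvac = 0"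
  "row_step n gamma SPlus SPlus H (gedge k) = inverse w * H (gedge (k + 1))"
  "row_step n gamma SMinus SMinus H (gedge k) = g (- k) * inverse w * H (gedge (k + 1))"
  "row_step n gamma SMinus SPlus H (gedge k) = (if int n dvd k then inverse w * H gvac else 0)"
  "row_step n gamma SPlus SMinus H (gedge k) = 0"
proof -
  have G1: "gedge 1 = (SPlus, 0)" by (simp add: gedge_def)
  have L: "(1 - k) mod int n = ((- k) mod int n + 1) mod int n" by (simp add: mod_simps)
  have V:
    "weight_val gamma (gedge k) SPlus (gedge (k + 1)) SPlus = inverse w"
    "weight_val gamma (gedge k) SMinus (gedge (k + 1)) SMinus = inverse w * g (- k)"
    by (auto simp: weight_val_def gedge_def L)
  show "row_step n gamma SPlus SPlus H gvac = H gvac"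
    by (subst row_step_single[of gvac]) (auto simp: weight_val_def edge_states_def split: option.splits if_splits)
  show "row_step n gamma SMinus SMinus H gvac = H gvac"
    by (subst row_step_single[of gvac]) (auto simp: weight_val_def edge_states_def split: option.splits if_splits)
  show "row_step n gamma SPlus SMinus H gvac = (1 - v) * H (gedge 1)"
    unfolding G1
    by (subst row_step_single[of "dvac"]) (auto simp: weight_val_def edge_states_def split: option.splits if_splits)
  show "row_step n gamma SMinus SPlus H gvac = 0"
    by (rule row_step_zero) (auto simp: weight_val_def edge_states_def)
  show "row_step n gamma SPlus SPlus H (gedge k) = inverse w * H (gedge (k + 1))"
    by (subst row_step_single[of "gedge (k + 1)"])
      (auto simp: V, auto simp: weight_val_def edge_states_def gedge_def gamma_label split: option.splits if_splits)
  show "row_step n gamma SMinus SMinus H (gedge k) = g (- k) * inverse w * H (gedge (k + 1))"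
    by (subst row_step_single[of "gedge (k + 1)"])
      (auto simp: V, auto simp: weight_val_def edge_states_def gedge_def gamma_label split: option.splits if_splits)
  show "row_step n gamma SMinus SPlus H (gedge k) = (if int n dvd k then inverse w * H gvac else 0)"
    by (subst row_step_single[of gvac])
      (auto simp: weight_val_def edge_states_def gedge_def gamma_pick split: option.splits if_splits)
  show "row_step n gamma SPlus SMinus H (gedge k) = 0"
    by (rule row_step_zero) (auto simp: weight_val_def edge_states_def gedge_def)
qed

text \<open>Gamma ice is the top row and is passed first, but the Delta edge stays the first
  argument of \<open>F\<close>. Both kinds of step then act on the same functions and can be
  intertwined.\<close>

definition step_DG ::
  "spin \<Rightarrow> spin \<Rightarrow> (dspin \<Rightarrow> dspin \<Rightarrow> complex) \<Rightarrow> dspin \<Rightarrow> dspin \<Rightarrow> complex" where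
  "step_DG t b F p q = pair_step n gamma delta t b (\<lambda>q' p'. F p' q') q p"

definition step_GD ::
  "spin \<Rightarrow> spin \<Rightarrow> (dspin \<Rightarrow> dspin \<Rightarrow> complex) \<Rightarrow> dspin \<Rightarrow> dspin \<Rightarrow> complex" where
  "step_GD t b F p q = pair_step n delta gamma t b F p q"

text \<open>With Gamma ice on top a pair of edges is created from the vacuum between two plus spins
  and absorbed between two minus spins; with Delta ice on top it is the reverse. Columns are plus
  far to the left and minus far to the right, so only the first order produces infinitely many
  intermediate vectors.\<close>

lemma step_DG_simps:
  "step_DG SPlus SPlus F dvac gvac = F dvac gvac + (1 - v) * F (dedge 1) (gedge 1)"
  "step_DG SPlus SPlus F (dedge k) gvac = z * F (dedge (k + 1)) gvac"
  "step_DG SPlus SPlus F dvac (gedge l) = inverse w * F dvac (gedge (l + 1))"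
  "step_DG SPlus SPlus F (dedge k) (gedge l) = x * F (dedge (k + 1)) (gedge (l + 1))"
  "step_DG SMinus SMinus F dvac gvac = F dvac gvac"
  "step_DG SMinus SMinus F (dedge k) gvac = g k * z * F (dedge (k + 1)) gvac"
  "step_DG SMinus SMinus F dvac (gedge l) = g (- l) * inverse w * F dvac (gedge (l + 1))"
  "step_DG SMinus SMinus F (dedge k) (gedge l) =
     g k * g (- l) * x * F (dedge (k + 1)) (gedge (l + 1))
     + (if int n dvd k \<and> int n dvd l then (1 - v) * x * F dvac gvac else 0)"
  "step_DG SPlus SMinus F dvac gvac = (1 - v) * F dvac (gedge 1)"
  "step_DG SPlus SMinus F (dedge k) gvac =
     (1 - v) * z * (g k * F (dedge (k + 1)) (gedge 1) + (if int n dvd k then F dvac gvac else 0))"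
  "step_DG SPlus SMinus F dvac (gedge l) = 0"
  "step_DG SPlus SMinus F (dedge k) (gedge l) =
     (if int n dvd k then (1 - v) * x * F dvac (gedge (l + 1)) else 0)"
  "step_DG SMinus SPlus F dvac gvac = F (dedge 1) gvac"
  "step_DG SMinus SPlus F (dedge k) gvac = 0"
  "step_DG SMinus SPlus F dvac (gedge l) =
     inverse w * (g (- l) * F (dedge 1) (gedge (l + 1)) + (if int n dvd l then F dvac gvac else 0))"
  "step_DG SMinus SPlus F (dedge k) (gedge l) =
     (if int n dvd l then x * F (dedge (k + 1)) gvac else 0)"
  by (simp_all add: step_DG_def pair_step_def delta_steps gamma_steps x_def divide_inverse algebra_simps)

lemma step_GD_simps:
  "step_GD SPlus SPlus F dvac gvac = F dvac gvac"
  "step_GD SPlus SPlus F (dedge k) gvac = z * F (dedge (k + 1)) gvac"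
  "step_GD SPlus SPlus F dvac (gedge l) = inverse w * F dvac (gedge (l + 1))"
  "step_GD SPlus SPlus F (dedge k) (gedge l) = x * F (dedge (k + 1)) (gedge (l + 1))
     + (if int n dvd k \<and> int n dvd l then (1 - v) * x * F dvac gvac else 0)"
  "step_GD SMinus SMinus F dvac gvac = F dvac gvac + (1 - v) * F (dedge 1) (gedge 1)"
  "step_GD SMinus SMinus F (dedge k) gvac = g k * z * F (dedge (k + 1)) gvac"
  "step_GD SMinus SMinus F dvac (gedge l) = g (- l) * inverse w * F dvac (gedge (l + 1))"
  "step_GD SMinus SMinus F (dedge k) (gedge l) =
     g k * g (- l) * x * F (dedge (k + 1)) (gedge (l + 1))"
  "step_GD SPlus SMinus F dvac gvac = (1 - v) * F dvac (gedge 1)"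
  "step_GD SPlus SMinus F (dedge k) gvac =
     (1 - v) * z * (F (dedge (k + 1)) (gedge 1) + (if int n dvd k then F dvac gvac else 0))"
  "step_GD SPlus SMinus F dvac (gedge l) = 0"
  "step_GD SPlus SMinus F (dedge k) (gedge l) =
     (if int n dvd k then (1 - v) * x * g (- l) * F dvac (gedge (l + 1)) else 0)"
  "step_GD SMinus SPlus F dvac gvac = F (dedge 1) gvac"
  "step_GD SMinus SPlus F (dedge k) gvac = 0"
  "step_GD SMinus SPlus F dvac (gedge l) =
     inverse w * (F (dedge 1) (gedge (l + 1)) + (if int n dvd l then F dvac gvac else 0))"
  "step_GD SMinus SPlus F (dedge k) (gedge l) =
     (if int n dvd l then g k * x * F (dedge (k + 1)) gvac else 0)"
  by (simp_all add: step_GD_def pair_step_def delta_steps gamma_steps x_def divide_inverse algebra_simps)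

end

section \<open>The Yang-Baxter equation\<close>

context ice_pair begin
text \<open>A pair is created with label 1 and has gathered \<open>x ^ (l - 1)\<close> on reaching
  label \<open>l\<close> through empty columns; one more factor \<open>x\<close> clears the negative
  power.\<close>

definition sigma :: "(dspin \<Rightarrow> dspin \<Rightarrow> complex) \<Rightarrow> nat \<Rightarrow> complex" where
  "sigma F k = (\<Sum>l=1..k. x ^ l * F (dedge (int l)) (gedge (int l)))"

text \<open>\<open>G = X F\<close> for the R-matrix \<open>X\<close>, with both sides multiplied by \<open>x\<close> or \<open>x ^ k\<close> in the block of the
  vacuum and the pairs of equal labels, so that no negative power of \<open>x\<close> occurs. The vacuum row of
  \<open>X\<close> is the sum over all columns to the left where the pair can have been created, and this row
  determines the rest.\<close>

definition intertwined ::
  "(dspin \<Rightarrow> dspin \<Rightarrow> complex) \<Rightarrow> (dspin \<Rightarrow> dspin \<Rightarrow> complex) \<Rightarrow> bool" where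
  "intertwined F G \<longleftrightarrow>
     x * G dvac gvac = x * (1 - x ^ n) * F dvac gvac + (1 - v) * sigma F n \<and>
     (\<forall>k. G (dedge k) gvac = (1 - v * x ^ n) * F (dedge k) gvac) \<and>
     (\<forall>l. G dvac (gedge l) = (1 - v * x ^ n) * F dvac (gedge l)) \<and>
     (\<forall>k l. \<not> int n dvd k - l \<longrightarrow> G (dedge k) (gedge l) =
       (1 - v * x ^ n) * g (k - l) * F (dedge k) (gedge l)) \<and>
     (\<forall>k\<in>{1..n}. x ^ k * G (dedge (int k)) (gedge (int k)) =
       (1 - v) * x ^ (n + 1) * F dvac gvac
       + (v\<^sup>2 * x ^ n - 1) * x ^ k * F (dedge (int k)) (gedge (int k))
       - (1 - v) * (sigma F n - sigma F k + v * x ^ n * sigma F (k - 1)))"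

lemma x_nonzero: "x \<noteq> 0"
  using z_nonzero w_nonzero by (simp add: x_def)

lemma edge_periodic [simp]: "dedge (int n + 1) = dedge 1" "gedge (int n + 1) = gedge 1"
  "dedge (1 + int n) = dedge 1" "gedge (1 + int n) = gedge 1"
  by (auto simp: dedge_def gedge_def mod_simps)

lemma label_cong:
  assumes "k mod int n = k' mod int n"
  shows "dedge k = dedge k'" "gedge k = gedge k'"
  using assms by (auto simp: dedge_def gedge_def intro: mod_diff_cong)

lemma sigma_Suc: "sigma F (Suc k) = sigma F k + x ^ Suc k * F (dedge (int (Suc k))) (gedge (int (Suc k)))"
  by (simp add: sigma_def)

lemma sigma_0 [simp]: "sigma F 0 = 0"
  by (simp add: sigma_def)

lemma int_dvd_small: "k \<ge> 1 \<Longrightarrow> k \<le> n \<Longrightarrow> int n dvd int k \<longleftrightarrow> k = n"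
  using dvd_imp_le by fastforce

lemma sigma_1 [simp]: "sigma F (Suc 0) = x * F (dedge 1) (gedge 1)"
  by (simp add: sigma_def)

section \<open>Effect of the four steps on the diagonal sums\<close>

lemma sigma_DG_plus:
  "sigma (step_DG SPlus SPlus F) k = sigma F (Suc k) - x * F (dedge 1) (gedge 1)"
  by (induction k) (simp_all add: sigma_Suc step_DG_simps algebra_simps)

lemma sigma_n_shift: "sigma F (Suc n) = sigma F n + x ^ Suc n * F (dedge 1) (gedge 1)"
  by (simp add: sigma_Suc algebra_simps)

text \<open>Below \<open>n\<close> every diagonal pair gains the same factor \<open>u\<close>. Label
  \<open>n\<close> is treated separately, since there the factor is \<open>u ^ 2\<close> and the
  pair can also be absorbed.\<close>

lemma sigma_DG_minus:
  assumes "k < n"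
  shows "sigma (step_DG SMinus SMinus F) k = u * (sigma F (Suc k) - x * F (dedge 1) (gedge 1))"
  using assms
proof (induction k)
  case (Suc k)
  then have "\<not> int n dvd int (Suc k)" using int_dvd_small[of "Suc k"] by simp
  then show ?case using Suc g_inv[of "int (Suc k)"]
    by (simp add: sigma_Suc[of _ "Suc k"] sigma_Suc[of _ k] step_DG_simps algebra_simps)
qed simp

lemma sigma_n: "sigma F n = sigma F (n - 1) + x ^ n * F (dedge (int n)) (gedge (int n))"
  using sigma_Suc[of F "n - 1"] by (simp del: power_Suc)

lemma g_n: "g (int n) = g 0" "g (- int n) = g 0"
  using g_mod[of "int n"] g_mod[of 0] g_mod[of "- int n"] by simp_all

lemma sigma_DG_minus_n:
  "sigma (step_DG SMinus SMinus F) n = u * (sigma F n - x * F (dedge 1) (gedge 1))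
    + x ^ n * (u\<^sup>2 * x * F (dedge 1) (gedge 1) + (1 - v) * x * F dvac gvac)"
proof -
  have "g (int n) * g (- int n) = u\<^sup>2" using g_zero by (simp add: g_n power2_eq_square)
  then show ?thesis using sigma_DG_minus[of "n - 1" F]
    by (simp add: sigma_n[of "step_DG SMinus SMinus F"] step_DG_simps)
qed

lemma sigma_DG_plus_minus:
  "k < n \<Longrightarrow> sigma (step_DG SPlus SMinus F) k = 0"
  "sigma (step_DG SPlus SMinus F) n = x ^ n * (1 - v) * x * F dvac (gedge 1)"
proof -
  show z: "sigma (step_DG SPlus SMinus F) k = 0" if "k < n" for k
    using that by (induction k) (auto simp: sigma_Suc step_DG_simps int_dvd_small[of "Suc k" for k, simplified])
  show "sigma (step_DG SPlus SMinus F) n = x ^ n * (1 - v) * x * F dvac (gedge 1)"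
    using z[of "n - 1"] by (simp add: sigma_n[of "step_DG SPlus SMinus F"] step_DG_simps)
qed

lemma sigma_DG_minus_plus:
  "k < n \<Longrightarrow> sigma (step_DG SMinus SPlus F) k = 0"
  "sigma (step_DG SMinus SPlus F) n = x ^ n * x * F (dedge 1) gvac"
proof -
  show z: "sigma (step_DG SMinus SPlus F) k = 0" if "k < n" for k
    using that by (induction k) (auto simp: sigma_Suc step_DG_simps int_dvd_small[of "Suc k" for k, simplified])
  show "sigma (step_DG SMinus SPlus F) n = x ^ n * x * F (dedge 1) gvac"
    using z[of "n - 1"] by (simp add: sigma_n[of "step_DG SMinus SPlus F"] step_DG_simps)
qed

text \<open>The labels \<open>1..n\<close> are written \<open>Suc j\<close> with
  \<open>j < n\<close>, which rids the last equation of the truncated difference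
  \<open>k - 1\<close>.\<close>

lemma intertwinedD:
  assumes "intertwined F G"
  shows "x * G dvac gvac = x * (1 - x ^ n) * F dvac gvac + (1 - v) * sigma F n"
    and "G (dedge k) gvac = (1 - v * x ^ n) * F (dedge k) gvac"
    and "G dvac (gedge l) = (1 - v * x ^ n) * F dvac (gedge l)"
    and "\<not> int n dvd k - l \<Longrightarrow> G (dedge k) (gedge l) =
       (1 - v * x ^ n) * g (k - l) * F (dedge k) (gedge l)"
    and "j < n \<Longrightarrow> x ^ Suc j * G (dedge (int (Suc j))) (gedge (int (Suc j))) =
       (1 - v) * x ^ (n + 1) * F dvac gvac
       + (v\<^sup>2 * x ^ n - 1) * x ^ Suc j * F (dedge (int (Suc j))) (gedge (int (Suc j)))
       - (1 - v) * (sigma F n - sigma F (Suc j) + v * x ^ n * sigma F j)"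
  using assms unfolding intertwined_def by (auto dest!: bspec[of _ _ "Suc j"] simp del: power_Suc)

lemma intertwinedI:
  assumes "x * G dvac gvac = x * (1 - x ^ n) * F dvac gvac + (1 - v) * sigma F n"
    and "\<And>k. G (dedge k) gvac = (1 - v * x ^ n) * F (dedge k) gvac"
    and "\<And>l. G dvac (gedge l) = (1 - v * x ^ n) * F dvac (gedge l)"
    and "\<And>k l. \<not> int n dvd k - l \<Longrightarrow> G (dedge k) (gedge l) =
       (1 - v * x ^ n) * g (k - l) * F (dedge k) (gedge l)"
    and "\<And>j. j < n \<Longrightarrow> x ^ Suc j * G (dedge (int (Suc j))) (gedge (int (Suc j))) =
       (1 - v) * x ^ (n + 1) * F dvac gvac
       + (v\<^sup>2 * x ^ n - 1) * x ^ Suc j * F (dedge (int (Suc j))) (gedge (int (Suc j)))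
       - (1 - v) * (sigma F n - sigma F (Suc j) + v * x ^ n * sigma F j)"
  shows "intertwined F G"
proof -
  have "x ^ k * G (dedge (int k)) (gedge (int k)) =
       (1 - v) * x ^ (n + 1) * F dvac gvac
       + (v\<^sup>2 * x ^ n - 1) * x ^ k * F (dedge (int k)) (gedge (int k))
       - (1 - v) * (sigma F n - sigma F k + v * x ^ n * sigma F (k - 1))" if "k \<in> {1..n}" for k
    using assms(5)[of "k - 1"] that by (cases k) (simp_all del: power_Suc)
  then show ?thesis unfolding intertwined_def using assms(1-4) by blast
qed

lemma int_Suc_plus: "int (Suc j) + 1 = int (Suc (Suc j))"
  by simp

section \<open>Intertwining for each choice of the outer vertical spins\<close>

lemma intertwined_plus:
  assumes "intertwined F G"
  shows "intertwined (step_DG SPlus SPlus F) (step_GD SPlus SPlus G)"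
proof (rule intertwinedI, goal_cases)
  case 1
  show ?case using intertwinedD(1)[OF assms] sigma_n_shift[of F]
    by (simp add: step_DG_simps step_GD_simps sigma_DG_plus algebra_simps)
next
  case (2 k)
  then show ?case using intertwinedD(2)[OF assms] by (simp add: step_DG_simps step_GD_simps)
next
  case (3 l)
  then show ?case using intertwinedD(3)[OF assms] by (simp add: step_DG_simps step_GD_simps)
next
  case (4 k l)
  then have "\<not> (int n dvd k \<and> int n dvd l)" by auto
  then show ?case using 4 intertwinedD(4)[OF assms, of "k + 1" "l + 1"]
    by (auto simp add: step_DG_simps step_GD_simps)
next
  case (5 j)
  define X Y where "X = x ^ n" and "Y = x ^ j"
  note XY = X_def[symmetric] Y_def[symmetric]
  show ?case
  proof (cases "Suc j = n")
    case False
    with 5 have j: "Suc j < n" by simp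
    then have nd: "\<not> int n dvd int (Suc j)" using int_dvd_small[of "Suc j"] by simp
    have nd': "(int n dvd int (Suc j)) = False" using nd by simp
    show ?thesis using intertwinedD(5)[OF assms j]
      unfolding step_DG_simps step_GD_simps sigma_DG_plus sigma_n_shift sigma_Suc[of F "Suc j"]
        int_Suc_plus nd' simp_thms if_False power_Suc power_add power_one_right XY
      by algebra
  next
    \<comment> \<open>The label after \<open>n\<close> is 1 again, and the step on \<open>G\<close>
      can absorb the pair. So the equation at label 1 and the vacuum equation both enter.\<close>
    case True
    then have Y: "x * Y = X" by (simp add: X_def Y_def flip: True)
    have j: "sigma F n = sigma F j + X * F (dedge (int n)) (gedge (int n))"
      using sigma_Suc[of F j] True by (simp add: X_def)
    show ?thesis
      using intertwinedD(5)[OF assms n_gt_0] intertwinedD(1)[OF assms] j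
      unfolding step_DG_simps step_GD_simps sigma_DG_plus True sigma_n_shift power_Suc power_add
        power_one_right XY
      by (simp add: Y) algebra
  qed
qed

text \<open>Here creation happens on the side of \<open>G\<close> and absorption on the side of
  \<open>F\<close>. The assumption \<open>v = u\<close> matches the products of values of
  \<open>g\<close> with the powers of \<open>v\<close> in the R-matrix.\<close>

lemma intertwined_minus:
  assumes "intertwined F G" "v = u"
  shows "intertwined (step_DG SMinus SMinus F) (step_GD SMinus SMinus G)"
proof (rule intertwinedI, goal_cases)
  case 1
  define X where "X = x ^ n"
  note X = X_def[symmetric]
  show ?case using intertwinedD(1)[OF assms(1)] intertwinedD(5)[OF assms(1) n_gt_0]
    unfolding step_DG_simps step_GD_simps sigma_DG_minus_n power_add X
    unfolding assms(2) by simp algebra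
next
  case (2 k)
  then show ?case using intertwinedD(2)[OF assms(1)] by (simp add: step_DG_simps step_GD_simps)
next
  case (3 l)
  then show ?case using intertwinedD(3)[OF assms(1)] by (simp add: step_DG_simps step_GD_simps)
next
  case (4 k l)
  then have "\<not> (int n dvd k \<and> int n dvd l)" by auto
  then show ?case using 4 intertwinedD(4)[OF assms(1), of "k + 1" "l + 1"]
    by (auto simp add: step_DG_simps step_GD_simps)
next
  case (5 j)
  define X Y where "X = x ^ n" and "Y = x ^ j"
  note XY = X_def[symmetric] Y_def[symmetric]
  show ?case
  proof (cases "Suc j = n")
    case False
    with 5 have j: "Suc j < n" by simp
    then have nd: "\<not> int n dvd int (Suc j)" using int_dvd_small[of "Suc j"] by simp
    have nd': "(int n dvd int (Suc j)) = False" using nd by simp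
    show ?thesis using intertwinedD(5)[OF assms(1) j]
      unfolding step_DG_simps step_GD_simps sigma_DG_minus[OF j] sigma_DG_minus[OF 5]
        sigma_DG_minus_n sigma_Suc[of F "Suc j"] int_Suc_plus nd' simp_thms if_False
        g_inv[OF nd] power_Suc power_add power_one_right XY
      unfolding assms(2) by algebra
  next
    case True
    then have Y: "x * Y = X" by (simp add: X_def Y_def flip: True)
    have "g 0 * g 0 = u\<^sup>2" using g_zero by (simp add: power2_eq_square)
    then have g0: "g (int n) * g (- int n) = u\<^sup>2" by (simp add: g_n)
    have j: "sigma F n = sigma F j + X * F (dedge (int n)) (gedge (int n))"
      using sigma_Suc[of F j] True by (simp add: X_def)
    show ?thesis
      using intertwinedD(5)[OF assms(1) n_gt_0]
      unfolding step_DG_simps step_GD_simps True sigma_DG_minus[OF 5] sigma_DG_minus_n g0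
        power_Suc power_add power_one_right XY
      unfolding assms(2) by (simp add: Y) algebra
  qed
qed

text \<open>These are the combinations met when the two outer spins differ: the step on
  \<open>G\<close> yields the left side, the step on \<open>F\<close> yields the bracket with
  \<open>g 0\<close> in place of \<open>- v\<close>. This is where the sign of \<open>g 0\<close>,
  and not only its square, matters.\<close>

lemma intertwined_first:
  assumes "intertwined F G"
  shows "G (dedge 1) (gedge 1) + G dvac gvac =
    (1 - v * x ^ n) * (F dvac gvac - v * F (dedge 1) (gedge 1))"
proof -
  define X where "X = x ^ n"
  have "x * (G (dedge 1) (gedge 1) + G dvac gvac) =
    x * ((1 - v * X) * (F dvac gvac - v * F (dedge 1) (gedge 1)))"
    using intertwinedD(5)[OF assms n_gt_0] intertwinedD(1)[OF assms]
    unfolding power_add power_one_right X_def[symmetric] by simp algebra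
  then show ?thesis using x_nonzero by (simp add: X_def)
qed

lemma intertwined_plus_minus:
  assumes "intertwined F G" "v = u" "g 0 = - v"
  shows "intertwined (step_DG SPlus SMinus F) (step_GD SPlus SMinus G)"
proof (rule intertwinedI, goal_cases)
  case 1
  show ?case unfolding step_DG_simps step_GD_simps sigma_DG_plus_minus intertwinedD(3)[OF assms(1)]
    by (simp add: algebra_simps)
next
  case (2 k)
  show ?case
  proof (cases "int n dvd k")
    case True
    then have k: "dedge (k + 1) = dedge 1" "g k = - v"
      using assms(3) g_mod[of k] by (auto simp: dedge_def elim!: dvdE)
    with True show ?thesis
      by (simp add: step_DG_simps step_GD_simps k intertwined_first[OF assms(1)] mult_ac)
  next
    case False
    then show ?thesis using intertwinedD(4)[OF assms(1), of "k + 1" 1]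
      by (simp add: step_DG_simps step_GD_simps)
  qed
next
  case (3 l)
  then show ?case by (simp add: step_DG_simps step_GD_simps)
next
  case (4 k l)
  \<comment> \<open>The reason for the entry \<open>g (k - l)\<close> at unequal labels: when the
    Delta edge ends at a label divisible by \<open>n\<close>, the Gamma vertex has weight
    \<open>g (- l)\<close> with Delta ice on top and no such factor in the other order.\<close>
  have "g (k - l) = g (- l)" if "int n dvd k"
    by (rule g_cong) (use that in \<open>simp add: mod_eq_dvd_iff\<close>)
  then show ?case using 4 intertwinedD(3)[OF assms(1), of "l + 1"]
    by (auto simp add: step_DG_simps step_GD_simps)
next
  case (5 j)
  define X Y where "X = x ^ n" and "Y = x ^ j"
  note XY = X_def[symmetric] Y_def[symmetric]
  show ?case
  proof (cases "Suc j = n")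
    case False
    with 5 have j: "Suc j < n" by simp
    then have nd: "\<not> int n dvd int (Suc j)" using int_dvd_small[of "Suc j"] by simp
    with j 5 show ?thesis
      by (simp add: step_DG_simps step_GD_simps sigma_DG_plus_minus del: of_nat_Suc)
  next
    case True
    then have Y: "x * Y = X" by (simp add: X_def Y_def flip: True)
    show ?thesis using intertwinedD(3)[OF assms(1), of 1]
      unfolding step_DG_simps step_GD_simps True sigma_DG_plus_minus g_n assms(3)
        power_Suc power_add power_one_right XY
      by (simp add: Y sigma_DG_plus_minus(1)[OF 5] mult_ac) (simp add: algebra_simps power2_eq_square)
  qed
qed

lemma intertwined_minus_plus:
  assumes "intertwined F G" "v = u" "g 0 = - v"
  shows "intertwined (step_DG SMinus SPlus F) (step_GD SMinus SPlus G)"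
proof (rule intertwinedI, goal_cases)
  case 1
  show ?case unfolding step_DG_simps step_GD_simps sigma_DG_minus_plus intertwinedD(2)[OF assms(1)]
    by (simp add: algebra_simps)
next
  case (2 k)
  then show ?case by (simp add: step_DG_simps step_GD_simps)
next
  case (3 l)
  show ?case
  proof (cases "int n dvd l")
    case True
    then have k: "gedge (l + 1) = gedge 1" "g (- l) = - v"
      using assms(3) g_mod[of "- l"] by (auto simp: gedge_def elim!: dvdE)
    with True show ?thesis
      by (simp add: step_DG_simps step_GD_simps k intertwined_first[OF assms(1)] mult_ac)
  next
    case False
    then show ?thesis using intertwinedD(4)[OF assms(1), of 1 "l + 1"]
      by (simp add: step_DG_simps step_GD_simps)
  qed
next
  case (4 k l)
  have "g (k - l) = g k" if "int n dvd l"
    by (rule g_cong) (use that in \<open>simp add: mod_eq_dvd_iff\<close>)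
  then show ?case using 4 intertwinedD(2)[OF assms(1), of "k + 1"]
    by (auto simp add: step_DG_simps step_GD_simps)
next
  case (5 j)
  define X Y where "X = x ^ n" and "Y = x ^ j"
  note XY = X_def[symmetric] Y_def[symmetric]
  show ?case
  proof (cases "Suc j = n")
    case False
    with 5 have j: "Suc j < n" by simp
    then have nd: "\<not> int n dvd int (Suc j)" using int_dvd_small[of "Suc j"] by simp
    with j 5 show ?thesis
      by (simp add: step_DG_simps step_GD_simps sigma_DG_minus_plus del: of_nat_Suc)
  next
    case True
    then have Y: "x * Y = X" by (simp add: X_def Y_def flip: True)
    show ?thesis using intertwinedD(2)[OF assms(1), of 1]
      unfolding step_DG_simps step_GD_simps True sigma_DG_minus_plus g_n assms(3)
        power_Suc power_add power_one_right XY
      by (simp add: Y sigma_DG_minus_plus(1)[OF 5] mult_ac) (simp add: algebra_simps power2_eq_square)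
  qed
qed
end

section \<open>The two ends of the strip\<close>

text \<open>\<open>F\<close> sits on the edge to the right of column \<open>c + 1\<close>; the
  columns \<open>c + 1, ..., c + k\<close> are then added from right to left.\<close>

primrec evolve :: "(int \<Rightarrow> 'a \<Rightarrow> 'a) \<Rightarrow> int \<Rightarrow> nat \<Rightarrow> 'a \<Rightarrow> 'a" where
  "evolve S c 0 F = F"
| "evolve S c (Suc k) F = S (c + 1 + int k) (evolve S c k F)"

lemma evolve_add: "evolve S c (j + k) F = evolve S (c + int j) k (evolve S c j F)"
  by (induction k) (simp_all add: algebra_simps)

lemma evolve_cong:
  assumes "\<And>i. c < i \<Longrightarrow> i \<le> c + int k \<Longrightarrow> S i = S' i"
  shows "evolve S c k F = evolve S' c k F"
  using assms by (induction k) simp_all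

lemma evolve_const: "evolve (\<lambda>_. f) c k F = (f ^^ k) F"
  by (induction k) simp_all

definition window :: "(int \<Rightarrow> 'a \<Rightarrow> 'a) \<Rightarrow> nat \<Rightarrow> 'a \<Rightarrow> 'a" where
  "window S N F = evolve S (- int N - 1) (2 * N + 1) F"

context ice_pair begin

section \<open>Absorption of pairs at the right end\<close>

definition vac :: "dspin \<Rightarrow> dspin \<Rightarrow> complex" where
  "vac p q = (if p = dvac \<and> q = gvac then 1 else 0)"

text \<open>Total weight of absorption for a pair that enters the occupied columns with label
  \<open>k\<close>. It takes \<open>(- k) mod n\<close> columns, each worth \<open>x * u\<close>, to
  reach a label divisible by \<open>n\<close>, where absorption costs \<open>(1 - v) * x\<close>.
  Each further lap multiplies by \<open>u ^ (n + 1) * x ^ n\<close>, and the denominator sums this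
  geometric series.\<close>

definition right_value :: "int \<Rightarrow> complex" where
  "right_value k = (1 - v) * x * (x * u) ^ nat ((- k) mod int n) / (1 - u ^ (n + 1) * x ^ n)"

text \<open>A Delta edge with decoration \<open>a\<close> and a Gamma edge with decoration
  \<open>b\<close> have equal labels exactly when \<open>a + b\<close> is 1 modulo
  \<open>n\<close>.\<close>

definition right_vector :: "dspin \<Rightarrow> dspin \<Rightarrow> complex" where
  "right_vector p q = (if p = dvac \<and> q = gvac then 1
     else if fst p = SMinus \<and> fst q = SPlus \<and> (snd p + snd q) mod int n = 1 mod int n
     then right_value (snd p) else 0)"

lemma vac_simps [simp]:
  "vac dvac gvac = 1" "vac (dedge k) gvac = 0" "vac dvac (gedge l) = 0" "vac (dedge k) (gedge l) = 0"
  by (auto simp: vac_def dedge_def gedge_def)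

lemma right_value_mod: "right_value (k mod int n) = right_value k"
  by (simp add: right_value_def mod_minus_eq)

lemma right_vector_simps [simp]:
  "right_vector dvac gvac = 1" "right_vector (dedge k) gvac = 0" "right_vector dvac (gedge l) = 0"
  "right_vector (dedge k) (gedge l) = (if int n dvd k - l then right_value k else 0)"
  by (auto simp: right_vector_def dedge_def gedge_def right_value_mod mod_add_eq mod_eq_dvd_iff)

text \<open>A pair can return to the vacuum only when its label is divisible by \<open>n\<close>, which happens
  \<open>passes k j\<close> times within \<open>j\<close> columns if it starts at \<open>k\<close>; this is where the geometric series
  over the returns is truncated.\<close>

definition passes :: "int \<Rightarrow> nat \<Rightarrow> nat" where
  "passes k j = nat ((k + int j - 1) div int n - (k - 1) div int n)"

lemma div_pred: "(k - 1) div int n = k div int n - (if int n dvd k then 1 else 0)"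
proof -
  define d r where "d = k div int n" and "r = k mod int n"
  have k: "k = int n * d + r" "0 \<le> r" "r < int n"
    by (simp_all add: d_def r_def)
  show ?thesis
  proof (cases "r = 0")
    case True
    then have dv: "int n dvd k" using k by simp
    have "(k - 1) div int n = d - 1"
      using k True n_pos by (intro int_div_pos_eq[where r = "int n - 1"]) (auto simp: algebra_simps)
    then show ?thesis using dv d_def by simp
  next
    case False
    then have dv: "\<not> int n dvd k" using r_def by auto
    have "(k - 1) div int n = d"
      using k False by (intro int_div_pos_eq[where r = "r - 1"]) (auto simp: algebra_simps)
    then show ?thesis using dv d_def by simp
  qed
qed

lemma passes_0 [simp]: "passes k 0 = 0"
  by (simp add: passes_def)

lemma passes_Suc: "passes k (Suc j) = passes (k + 1) j + (if int n dvd k then 1 else 0)"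
proof -
  have "(k + int j) div int n \<ge> k div int n" by (intro zdiv_mono1) auto
  then show ?thesis using div_pred[of k] by (auto simp: passes_def algebra_simps)
qed

lemma passes_at_top: "filterlim (passes k) at_top sequentially"
proof (rule filterlim_at_top[THEN iffD2], rule allI)
  fix Z :: nat
  have "Z \<le> passes k j" if "j \<ge> n * (Z + 1)" for j
  proof -
    have "(k - 1) div int n + int (Z + 1) = ((k - 1) + int n * int (Z + 1)) div int n"
      by simp
    also have "\<dots> \<le> (k + int j - 1) div int n"
    proof (rule zdiv_mono1)
      have "int n * int (Z + 1) \<le> int j" using that by (metis of_nat_le_iff of_nat_mult)
      then show "k - 1 + int n * int (Z + 1) \<le> k + int j - 1" by simp
    qed simp
    finally show ?thesis by (simp add: passes_def)
  qed
  then show "eventually (\<lambda>j. Z \<le> passes k j) sequentially"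
    unfolding eventually_sequentially by blast
qed

lemma g_pair: "int n dvd k - l \<Longrightarrow> g k * g (- l) = (if int n dvd k then u\<^sup>2 else u)"
proof -
  assume a: "int n dvd k - l"
  have "(- l) mod int n = (- k) mod int n"
    using a by (simp add: mod_eq_dvd_iff)
  then have l: "g (- l) = g (- k)" by (rule g_cong)
  show ?thesis
  proof (cases "int n dvd k")
    case True
    then have "k mod int n = 0 mod int n" "(- k) mod int n = 0 mod int n" by auto
    then have "g k = g 0" "g (- k) = g 0" by (auto intro!: g_cong)
    then show ?thesis using True l g_zero by (simp add: power2_eq_square)
  next
    case False
    then show ?thesis using l g_inv by simp
  qed
qed

text \<open>The three ways through an occupied column: the pair moves on at a label not divisible by
  \<open>n\<close>, and otherwise it passes or is absorbed. The last two equations add up to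
  \<open>right_value k\<close>, so \<open>right_vector\<close> is fixed by the step.\<close>

lemma right_value_rec:
  assumes "u ^ (n + 1) * x ^ n \<noteq> 1"
  shows "\<not> int n dvd k \<Longrightarrow> u * x * right_value (k + 1) = right_value k"
    and "int n dvd k \<Longrightarrow> u\<^sup>2 * x * right_value (k + 1) = u ^ (n + 1) * x ^ n * right_value k"
    and "int n dvd k \<Longrightarrow> right_value k * (1 - u ^ (n + 1) * x ^ n) = (1 - v) * x"
proof -
  assume a: "\<not> int n dvd k"
  have "(- k) mod int n = (- (k + 1)) mod int n + 1"
  proof -
    have "(- (k + 1)) mod int n = ((- k) mod int n - 1) mod int n" by (simp add: mod_simps)
    also have "\<dots> = (- k) mod int n - 1"
    proof (rule mod_pos_pos_trivial)
      have "(- k) mod int n \<noteq> 0" using a by (simp add: mod_eq_0_iff_dvd)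
      moreover have "0 \<le> (- k) mod int n" "(- k) mod int n < int n" by simp_all
      ultimately show "0 \<le> (- k) mod int n - 1" "(- k) mod int n - 1 < int n" by linarith+
    qed
    finally show ?thesis by simp
  qed
  then have "nat ((- k) mod int n) = Suc (nat ((- (k + 1)) mod int n))"
    by (simp add: nat_add_distrib)
  then show "u * x * right_value (k + 1) = right_value k"
    by (simp add: right_value_def)
next
  assume a: "int n dvd k"
  have 1: "nat ((- k) mod int n) = 0" using a by simp
  have "(- (k + 1)) mod int n = (- 1) mod int n" using a by (simp add: mod_eq_dvd_iff)
  also have "\<dots> = int n - 1" by (simp add: zmod_minus1)
  finally have 2: "nat ((- (k + 1)) mod int n) = n - 1" using n_pos by simp
  have "x * x ^ (n - 1) = x ^ n" "u ^ (n - 1) * u\<^sup>2 = u ^ (n + 1)"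
    using n_pos by (simp_all flip: power_Suc power_add)
  then have "(u * u) * x * (x * (x * u) ^ (n - 1)) = u ^ (n + 1) * x ^ n * x"
    unfolding power_mult_distrib power2_eq_square by (metis mult.assoc mult.commute)
  note eq = this
  define E where "E = 1 - u ^ (n + 1) * x ^ n"
  have "u\<^sup>2 * x * right_value (k + 1) = (u * u) * x * (x * (x * u) ^ (n - 1)) * (1 - v) / E"
    unfolding right_value_def 2 power2_eq_square E_def[symmetric] by simp
  also have "\<dots> = u ^ (n + 1) * x ^ n * right_value k"
    unfolding eq right_value_def 1 E_def[symmetric] by simp
  finally show "u\<^sup>2 * x * right_value (k + 1) = u ^ (n + 1) * x ^ n * right_value k" .
  show "right_value k * (1 - u ^ (n + 1) * x ^ n) = (1 - v) * x"
    using assms by (simp add: right_value_def 1)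
qed

text \<open>Labels that differ modulo \<open>n\<close> keep differing, so such edges are never
  absorbed together. For equal labels each chance of absorption contributes one term of a geometric
  series, and stopping after \<open>j\<close> columns cuts off its tail.\<close>

lemma right_end:
  assumes "u ^ (n + 1) * x ^ n \<noteq> 1"
  defines "E \<equiv> \<lambda>j. (step_DG SMinus SMinus ^^ j) vac"
  shows "E j dvac gvac = 1" "E j (dedge k) gvac = 0" "E j dvac (gedge l) = 0"
    "E j (dedge k) (gedge l) = (if int n dvd k - l
       then right_value k * (1 - (u ^ (n + 1) * x ^ n) ^ passes k j) else 0)"
proof -
  show v: "E j dvac gvac = 1" for j
    unfolding E_def by (induction j) (simp_all add: step_DG_simps)
  show "E j (dedge k) gvac = 0"
    unfolding E_def by (induction j arbitrary: k) (simp_all add: step_DG_simps)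
  show "E j dvac (gedge l) = 0"
    unfolding E_def by (induction j arbitrary: l) (simp_all add: step_DG_simps)
  show "E j (dedge k) (gedge l) = (if int n dvd k - l
       then right_value k * (1 - (u ^ (n + 1) * x ^ n) ^ passes k j) else 0)"
  proof (induction j arbitrary: k l)
    case 0
    then show ?case by (simp add: E_def)
  next
    case (Suc j)
    define Q where "Q = u ^ (n + 1) * x ^ n"
    have S: "E (Suc j) = step_DG SMinus SMinus (E j)" by (simp add: E_def)
    show ?case
    proof (cases "int n dvd k - l")
      case False
      then have "\<not> (int n dvd k \<and> int n dvd l)" by auto
      with False Suc.IH show ?thesis by (auto simp: S step_DG_simps)
    next
      case kl: True
      have dl: "int n dvd l \<longleftrightarrow> int n dvd k"
        using dvd_add_right_iff[OF kl, of l] by simp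
      show ?thesis
      proof (cases "int n dvd k")
        case True
        have "E (Suc j) (dedge k) (gedge l) =
          (u\<^sup>2 * x * right_value (k + 1)) * (1 - Q ^ passes (k + 1) j) + (1 - v) * x"
          using kl True Suc.IH[of "k + 1" "l + 1"] v
          by (simp add: S step_DG_simps g_pair dl Q_def mult.assoc)
        also have "\<dots> = Q * right_value k * (1 - Q ^ passes (k + 1) j) + right_value k * (1 - Q)"
          unfolding right_value_rec(2)[OF assms(1) True] right_value_rec(3)[OF assms(1) True, symmetric]
          by (simp only: Q_def)
        also have "\<dots> = right_value k * (1 - Q ^ passes k (Suc j))"
          using True by (simp add: passes_Suc algebra_simps)
        finally show ?thesis using kl by (simp add: Q_def)
      next
        case False
        have "E (Suc j) (dedge k) (gedge l) =
          (u * x * right_value (k + 1)) * (1 - Q ^ passes (k + 1) j)"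
          using kl False Suc.IH[of "k + 1" "l + 1"]
          by (simp add: S step_DG_simps g_pair Q_def mult.assoc)
        also have "\<dots> = right_value k * (1 - Q ^ passes k (Suc j))"
          unfolding right_value_rec(1)[OF assms(1) False] using False by (simp add: passes_Suc)
        finally show ?thesis using kl by (simp add: Q_def)
      qed
    qed
  qed
qed

lemma tendsto_if:
  assumes "(f \<longlongrightarrow> a) L" "(f' \<longlongrightarrow> a') L"
  shows "((\<lambda>j. if P then f j else f' j) \<longlongrightarrow> (if P then a else a')) L"
  using assms by simp

text \<open>These four kinds of argument contain the vacuum and are closed under the steps: a Delta
  edge \<open>+\<close> and a Gamma edge \<open>-\<close> occur only undecorated.\<close>

definition converges_to ::
  "(nat \<Rightarrow> dspin \<Rightarrow> dspin \<Rightarrow> complex) \<Rightarrow> (dspin \<Rightarrow> dspin \<Rightarrow> complex) \<Rightarrow> bool" where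
  "converges_to Fs F \<longleftrightarrow> (\<lambda>j. Fs j dvac gvac) \<longlonglongrightarrow> F dvac gvac \<and>
     (\<forall>k. (\<lambda>j. Fs j (dedge k) gvac) \<longlonglongrightarrow> F (dedge k) gvac) \<and>
     (\<forall>l. (\<lambda>j. Fs j dvac (gedge l)) \<longlonglongrightarrow> F dvac (gedge l)) \<and>
     (\<forall>k l. (\<lambda>j. Fs j (dedge k) (gedge l)) \<longlonglongrightarrow> F (dedge k) (gedge l))"

lemma converges_to_step:
  assumes "converges_to Fs F"
  shows "converges_to (\<lambda>j. step_DG t b (Fs j)) (step_DG t b F)"
proof -
  note lims = assms[unfolded converges_to_def, THEN conjunct1]
    assms[unfolded converges_to_def, THEN conjunct2, THEN conjunct1, rule_format]
    assms[unfolded converges_to_def, THEN conjunct2, THEN conjunct2, THEN conjunct1, rule_format]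
    assms[unfolded converges_to_def, THEN conjunct2, THEN conjunct2, THEN conjunct2, rule_format]
  show ?thesis
    by (cases t; cases b; simp only: converges_to_def step_DG_simps;
        intro conjI allI tendsto_add tendsto_mult tendsto_const tendsto_if lims)
qed

lemma converges_to_evolve:
  assumes "converges_to Fs F"
  shows "converges_to (\<lambda>j. evolve (\<lambda>c. step_DG (t c) (b c)) c k (Fs j))
    (evolve (\<lambda>c. step_DG (t c) (b c)) c k F)"
  by (induction k) (simp_all add: assms converges_to_step)

lemma right_end_converges:
  assumes "norm (u ^ (n + 1) * x ^ n) < 1"
  shows "converges_to (\<lambda>j. (step_DG SMinus SMinus ^^ j) vac) right_vector"
proof -
  have ne: "u ^ (n + 1) * x ^ n \<noteq> 1" using assms by force
  have "(\<lambda>j. (u ^ (n + 1) * x ^ n) ^ passes k j) \<longlonglongrightarrow> 0" for k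
    by (rule filterlim_compose[OF LIMSEQ_power_zero passes_at_top]) (use assms in auto)
  then have "(\<lambda>j. right_value k * (1 - (u ^ (n + 1) * x ^ n) ^ passes k j)) \<longlonglongrightarrow> right_value k * (1 - 0)" for k
    by (intro tendsto_intros)
  then show ?thesis unfolding converges_to_def by (auto simp: right_end[OF ne])
qed

section \<open>Creation of pairs at the left end\<close>

definition left_functional :: "(dspin \<Rightarrow> dspin \<Rightarrow> complex) \<Rightarrow> complex" where
  "left_functional F = x * (1 - x ^ n) * F dvac gvac + (1 - v) * sigma F n"

text \<open>The step shifts the diagonal sum. Creation from the vacuum restores the lost term of
  label 1, and the factor \<open>1 - x ^ n\<close> cancels the new term of label
  \<open>n + 1\<close>, which is label 1 again.\<close>

lemma left_functional_plus: "left_functional (step_DG SPlus SPlus F) = left_functional F"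
  unfolding left_functional_def sigma_DG_plus sigma_n_shift step_DG_simps
  by (simp add: algebra_simps)

lemma left_functional_evolve: "left_functional ((step_DG SPlus SPlus ^^ j) F) = left_functional F"
  by (induction j) (simp_all add: left_functional_plus)

lemma evolve_plus:
  "(step_DG SPlus SPlus ^^ j) F (dedge k) (gedge l) = x ^ j * F (dedge (k + int j)) (gedge (l + int j))"
  by (induction j arbitrary: k l) (simp_all add: step_DG_simps algebra_simps)

lemma diagonal_bound:
  "norm (F (dedge k) (gedge k)) \<le> (\<Sum>i=1..n. norm (F (dedge (int i)) (gedge (int i))))"
proof -
  \<comment> \<open>The representative of \<open>k\<close> in \<open>{1..n}\<close>; the class of 0
    is represented by \<open>n\<close>.\<close>
  define i where "i = (if int n dvd k then n else nat (k mod int n))"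
  have i: "i \<in> {1..n} \<and> k mod int n = int i mod int n"
  proof (cases "int n dvd k")
    case True
    then show ?thesis using n_pos by (simp add: i_def)
  next
    case False
    then have "k mod int n \<noteq> 0" by (simp add: mod_eq_0_iff_dvd)
    moreover have "0 \<le> k mod int n" "k mod int n < int n" by simp_all
    ultimately have "0 < k mod int n" "k mod int n < int n" by linarith+
    then obtain r where "k mod int n = int r" "0 < r" "r < n"
      using zero_less_imp_eq_int by (metis of_nat_0_less_iff of_nat_less_iff)
    then show ?thesis using False by (simp add: i_def)
  qed
  have "dedge k = dedge (int i)" "gedge k = gedge (int i)"
    using i label_cong by blast+
  then show ?thesis
    using i member_le_sum[of i "{1..n}" "\<lambda>i. norm (F (dedge (int i)) (gedge (int i)))"] by simp
qed

text \<open>The invariant functional is \<open>x * (1 - x ^ n)\<close> times the vacuum entry plus a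
  multiple of the diagonal sum, so it suffices that the latter dies out. \<open>Fs\<close> depends
  on \<open>j\<close> because both ends of a window grow at once.\<close>

lemma left_end:
  assumes "norm x < 1" and "converges_to Fs F"
  shows "(\<lambda>j. (step_DG SPlus SPlus ^^ j) (Fs j) dvac gvac) \<longlonglongrightarrow> left_functional F / (x * (1 - x ^ n))"
proof -
  have lim: "(\<lambda>j. Fs j dvac gvac) \<longlonglongrightarrow> F dvac gvac"
    "\<And>k l. (\<lambda>j. Fs j (dedge k) (gedge l)) \<longlonglongrightarrow> F (dedge k) (gedge l)"
    using assms(2) by (auto simp: converges_to_def)
  have "norm (x ^ n) < 1" using assms(1) by (simp add: norm_power power_less_one_iff)
  then have xn: "x * (1 - x ^ n) \<noteq> 0" using x_nonzero by auto
  \<comment> \<open>One bound for all labels. It converges with \<open>Fs\<close>, so it is bounded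
    and cannot outweigh \<open>norm x ^ j\<close>.\<close>
  define B where "B = (\<lambda>j. \<Sum>i=1..n. norm (Fs j (dedge (int i)) (gedge (int i))))"
  have B: "B \<longlonglongrightarrow> (\<Sum>i=1..n. norm (F (dedge (int i)) (gedge (int i))))"
    unfolding B_def by (intro tendsto_intros lim)
  have sig: "(\<lambda>j. sigma ((step_DG SPlus SPlus ^^ j) (Fs j)) n) \<longlonglongrightarrow> 0"
  proof (rule Lim_null_comparison)
    have "(\<lambda>j. real n * (norm x ^ j * B j)) \<longlonglongrightarrow> real n * (0 * (\<Sum>i=1..n. norm (F (dedge (int i)) (gedge (int i)))))"
      using assms(1) by (intro tendsto_intros B) auto
    then show "(\<lambda>j. real n * (norm x ^ j * B j)) \<longlonglongrightarrow> 0" by simp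
    show "\<forall>\<^sub>F j in sequentially. norm (sigma ((step_DG SPlus SPlus ^^ j) (Fs j)) n) \<le> real n * (norm x ^ j * B j)"
    proof (rule always_eventually, rule allI)
      fix j
      have "norm (x ^ l * (step_DG SPlus SPlus ^^ j) (Fs j) (dedge (int l)) (gedge (int l))) \<le> norm x ^ j * B j" for l
      proof -
        have "norm (x ^ l) \<le> 1" using assms(1) by (simp add: norm_power power_le_one)
        moreover have "norm ((step_DG SPlus SPlus ^^ j) (Fs j) (dedge (int l)) (gedge (int l))) \<le> norm x ^ j * B j"
          using diagonal_bound[of "Fs j" "int l + int j"]
          by (auto simp: evolve_plus norm_mult norm_power B_def intro!: mult_left_mono)
        ultimately show ?thesis
          using mult_mono[of "norm (x ^ l)" 1] by (simp add: norm_mult)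
      qed
      then have "norm (sigma ((step_DG SPlus SPlus ^^ j) (Fs j)) n) \<le> (\<Sum>l=1..n. norm x ^ j * B j)"
        unfolding sigma_def by (intro sum_norm_le) auto
      then show "norm (sigma ((step_DG SPlus SPlus ^^ j) (Fs j)) n) \<le> real n * (norm x ^ j * B j)" by simp
    qed
  qed
  have "(\<lambda>j. left_functional (Fs j)) \<longlonglongrightarrow> left_functional F"
    unfolding left_functional_def sigma_def by (intro tendsto_intros lim)
  moreover have "(step_DG SPlus SPlus ^^ j) (Fs j) dvac gvac =
     (left_functional (Fs j) - (1 - v) * sigma ((step_DG SPlus SPlus ^^ j) (Fs j)) n) / (x * (1 - x ^ n))" for j
    using left_functional_evolve[of j "Fs j"] xn unfolding left_functional_def
    by (simp add: field_simps)
  moreover have "(\<lambda>j. (left_functional (Fs j) - (1 - v) * sigma ((step_DG SPlus SPlus ^^ j) (Fs j)) n) / (x * (1 - x ^ n)))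
     \<longlonglongrightarrow> (left_functional F - (1 - v) * 0) / (x * (1 - x ^ n))"
    using calculation(1) by (intro tendsto_intros sig xn)
  ultimately show ?thesis by simp
qed

section \<open>Limit over growing windows\<close>

lemma window_limit:
  assumes "norm x < 1" "norm (u ^ (n + 1) * x ^ n) < 1"
    and plus: "\<And>c. c > int N0 \<Longrightarrow> t c = SPlus \<and> b c = SPlus"
    and minus: "\<And>c. c < - int N0 \<Longrightarrow> t c = SMinus \<and> b c = SMinus"
  defines "S \<equiv> \<lambda>c. step_DG (t c) (b c)"
  shows "(\<lambda>N. window S N vac dvac gvac) \<longlonglongrightarrow>
    left_functional (window S N0 right_vector) / (x * (1 - x ^ n))"
proof -
  have "window S (j + N0) vac =
    (step_DG SPlus SPlus ^^ j) (window S N0 ((step_DG SMinus SMinus ^^ j) vac))" for j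
  proof -
    \<comment> \<open>From right to left: \<open>j\<close> occupied columns, the fixed middle
      window, \<open>j\<close> empty columns.\<close>
    have "2 * (j + N0) + 1 = j + ((2 * N0 + 1) + j)" by simp
    then have "window S (j + N0) vac = evolve S (- int (j + N0) - 1 + int j + int (2 * N0 + 1)) j
      (evolve S (- int (j + N0) - 1 + int j) (2 * N0 + 1) (evolve S (- int (j + N0) - 1) j vac))"
      unfolding window_def by (simp only: evolve_add)
    also have "evolve S (- int (j + N0) - 1) j vac = (step_DG SMinus SMinus ^^ j) vac"
      unfolding evolve_const[symmetric, where c = "- int (j + N0) - 1"]
      by (rule evolve_cong) (use minus in \<open>auto simp: S_def\<close>)
    also have "evolve S (- int (j + N0) - 1 + int j + int (2 * N0 + 1)) j F = (step_DG SPlus SPlus ^^ j) F" for F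
      unfolding evolve_const[symmetric, where c = "- int (j + N0) - 1 + int j + int (2 * N0 + 1)"]
      by (rule evolve_cong) (use plus in \<open>auto simp: S_def\<close>)
    also have "- int (j + N0) - 1 + int j = - int N0 - 1" by simp
    finally show ?thesis by (simp add: window_def)
  qed
  moreover have "(\<lambda>j. (step_DG SPlus SPlus ^^ j) (window S N0 ((step_DG SMinus SMinus ^^ j) vac)) dvac gvac)
    \<longlonglongrightarrow> left_functional (window S N0 right_vector) / (x * (1 - x ^ n))"
    unfolding window_def S_def
    by (intro left_end converges_to_evolve right_end_converges assms(1,2))
  ultimately have "(\<lambda>j. window S (j + N0) vac dvac gvac) \<longlonglongrightarrow>
    left_functional (window S N0 right_vector) / (x * (1 - x ^ n))" by simp
  then show ?thesis by (rule LIMSEQ_offset)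
qed

section \<open>Moving the R-matrix through the strip\<close>

lemma intertwined_step:
  assumes "intertwined F G" "v = u" "g 0 = - v"
  shows "intertwined (step_DG t b F) (step_GD t b G)"
  using assms intertwined_plus intertwined_minus intertwined_plus_minus intertwined_minus_plus
  by (cases t; cases b) auto

lemma intertwined_evolve:
  assumes "intertwined F G" "v = u" "g 0 = - v"
  shows "intertwined (evolve (\<lambda>c. step_DG (t c) (b c)) c k F) (evolve (\<lambda>c. step_GD (t c) (b c)) c k G)"
  by (induction k) (simp_all add: assms(1) intertwined_step[OF _ assms(2,3)])

lemma step_GD_scale: "step_GD t b (\<lambda>p q. a * F p q) = (\<lambda>p q. a * step_GD t b F p q)"
  by (simp add: fun_eq_iff step_GD_def pair_step_def row_step_def sum_distrib_left algebra_simps)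

lemma evolve_GD_scale: "evolve (\<lambda>c. step_GD (t c) (b c)) c k (\<lambda>p q. a * F p q) =
    (\<lambda>p q. a * evolve (\<lambda>c. step_GD (t c) (b c)) c k F p q)"
  by (induction k) (simp_all add: step_GD_scale)

lemma right_value_Suc:
  assumes "j < n" "v = u" "u ^ (n + 1) * x ^ n \<noteq> 1"
  shows "x ^ Suc j * right_value (int (Suc j)) * (1 - v ^ (n + 1) * x ^ n) =
    (1 - v) * x ^ (n + 1) * v ^ (n - Suc j)"
proof -
  have "(- int (Suc j)) mod int n = (int (n - Suc j)) mod int n"
    using assms(1) by (simp add: mod_eq_dvd_iff of_nat_diff)
  also have "\<dots> = int (n - Suc j)"
    using assms(1) by (intro mod_pos_pos_trivial) auto
  finally have m: "nat ((- int (Suc j)) mod int n) = n - Suc j" by simp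
  have xn: "x ^ Suc j * x ^ (n - Suc j) = x ^ n"
    using assms(1) by (simp del: power_Suc flip: power_add)
  have "x ^ Suc j * ((1 - v) * x * (x * v) ^ (n - Suc j)) =
      (x ^ Suc j * x ^ (n - Suc j)) * ((1 - v) * x * v ^ (n - Suc j))"
    by (simp add: power_mult_distrib mult_ac)
  also have "\<dots> = (1 - v) * x ^ (n + 1) * v ^ (n - Suc j)"
    unfolding xn by (simp add: mult_ac)
  finally have "x ^ Suc j * ((1 - v) * x * (x * v) ^ (n - Suc j)) = (1 - v) * x ^ (n + 1) * v ^ (n - Suc j)" .
  then show ?thesis using assms(2,3) unfolding right_value_def m by simp
qed

text \<open>After the denominator is cleared, the term of label \<open>l\<close> is
  \<open>x ^ (n + 1)\<close> times \<open>(1 - v) * v ^ (n - l)\<close>, a difference of consecutive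
  powers of \<open>v\<close>, so the sum telescopes.\<close>

lemma sigma_right_vector:
  assumes "k \<le> n" "v = u" "u ^ (n + 1) * x ^ n \<noteq> 1"
  shows "sigma right_vector k * (1 - v ^ (n + 1) * x ^ n) = x ^ (n + 1) * (v ^ (n - k) - v ^ n)"
  using assms(1)
proof (induction k)
  case (Suc j)
  then have e: "v ^ (n - j) = v * v ^ (n - Suc j)" by (simp add: Suc_diff_Suc flip: power_Suc)
  have "sigma right_vector (Suc j) * (1 - v ^ (n + 1) * x ^ n) =
    sigma right_vector j * (1 - v ^ (n + 1) * x ^ n) +
    x ^ Suc j * right_value (int (Suc j)) * (1 - v ^ (n + 1) * x ^ n)"
    unfolding sigma_Suc by (simp add: distrib_right)
  also have "\<dots> = x ^ (n + 1) * (v ^ (n - j) - v ^ n) + (1 - v) * x ^ (n + 1) * v ^ (n - Suc j)"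
    using Suc right_value_Suc[OF _ assms(2,3), of j] by (simp del: power_Suc of_nat_Suc)
  also have "\<dots> = x ^ (n + 1) * (v ^ (n - Suc j) - v ^ n)"
    unfolding e by (simp add: algebra_simps)
  finally show ?case .
qed simp

text \<open>With \<open>X = x ^ n\<close> and \<open>V = v ^ n\<close> the numerator of
  \<open>C\<close> comes from (1 - X)(1 - v V X) + (1 - v)(1 - V) X = (1 - v X)(1 - V X). In every
  diagonal row the contributions cancel, which leaves a multiple of the vacuum, the starting vector
  of the other product.\<close>

lemma intertwined_right_vector:
  assumes "v = u" "u ^ (n + 1) * x ^ n \<noteq> 1"
  defines "C \<equiv> (1 - v * x ^ n) * (1 - v ^ n * x ^ n) / (1 - v ^ (n + 1) * x ^ n)"
  shows "intertwined right_vector (\<lambda>p q. C * vac p q)"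
proof (rule intertwinedI, goal_cases)
  case 1
  define X V E where "X = x ^ n" and "V = v ^ n" and "E = 1 - v * V * X"
  have E: "E \<noteq> 0" using assms(1,2) by (simp add: E_def V_def X_def)
  have "C * E = (1 - v * X) * (1 - V * X)"
    using E by (simp add: C_def E_def V_def X_def)
  moreover have "sigma right_vector n * E = x * X * (1 - V)"
    using sigma_right_vector[OF order_refl assms(1,2)] by (simp add: E_def V_def X_def)
  ultimately have "(x * C) * E = (x * (1 - X) + (1 - v) * sigma right_vector n) * E"
    unfolding E_def by algebra
  then show ?case using E by (simp add: X_def)
next
  case (5 j)
  define X V E where "X = x ^ n" and "V = v ^ n" and "E = 1 - v * V * X"
  define a where "a = v ^ (n - Suc j)"
  have E: "E \<noteq> 0" using assms(1,2) by (simp add: E_def V_def X_def)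
  have va: "v ^ (n - j) = v * a" using 5 by (simp add: a_def Suc_diff_Suc flip: power_Suc)
  define s s1 s2 r where "s = sigma right_vector n" and "s1 = sigma right_vector (Suc j)"
    and "s2 = sigma right_vector j" and "r = x ^ Suc j * right_value (int (Suc j))"
  have h: "s * E = x * X * (1 - V)" "s1 * E = x * X * (a - V)" "s2 * E = x * X * (v * a - V)"
    "r * E = (1 - v) * (x * X) * a"
    using sigma_right_vector[OF _ assms(1,2), of n] sigma_right_vector[OF _ assms(1,2), of "Suc j"]
      sigma_right_vector[OF _ assms(1,2), of j] right_value_Suc[OF 5 assms(1,2)] 5 va
    by (simp_all add: E_def V_def X_def a_def s_def s1_def s2_def r_def del: of_nat_Suc)
  have "((1 - v) * (x * X) + (v\<^sup>2 * X - 1) * r - (1 - v) * (s - s1 + v * X * s2)) * E =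
      (1 - v) * (x * X) * E + (v\<^sup>2 * X - 1) * (r * E) - (1 - v) * (s * E - s1 * E + v * X * (s2 * E))"
    by (simp add: algebra_simps)
  also have "\<dots> = 0" unfolding h unfolding E_def by (simp add: algebra_simps power2_eq_square)
  finally have "(1 - v) * (x * X) + (v\<^sup>2 * X - 1) * r - (1 - v) * (s - s1 + v * X * s2) = 0"
    using E by simp
  then show ?case
    by (simp add: s_def s1_def s2_def r_def X_def mult.assoc del: of_nat_Suc)
qed simp_all

text \<open>The denominator \<open>1 - x ^ n\<close> stems from the laps of pairs created on the
  left; the rest of the factor is the constant \<open>C\<close> of the right end.\<close>

lemma product_limit:
  assumes "v = u" "g 0 = - v"
    and "norm x < 1" "norm (v ^ (n + 1) * x ^ n) < 1"
    and "\<And>c. c > int N0 \<Longrightarrow> t c = SPlus \<and> b c = SPlus"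
    and "\<And>c. c < - int N0 \<Longrightarrow> t c = SMinus \<and> b c = SMinus"
  shows "(\<lambda>N. window (\<lambda>c. step_DG (t c) (b c)) N vac dvac gvac) \<longlonglongrightarrow>
    (1 - v * x ^ n) * (1 - v ^ n * x ^ n) / ((1 - x ^ n) * (1 - v ^ (n + 1) * x ^ n)) *
    window (\<lambda>c. step_GD (t c) (b c)) N0 vac dvac gvac"
proof -
  define C where "C = (1 - v * x ^ n) * (1 - v ^ n * x ^ n) / (1 - v ^ (n + 1) * x ^ n)"
  have u: "norm (u ^ (n + 1) * x ^ n) < 1" using assms(1,4) by simp
  then have ne: "u ^ (n + 1) * x ^ n \<noteq> 1" by force
  have "intertwined (window (\<lambda>c. step_DG (t c) (b c)) N0 right_vector)
    (window (\<lambda>c. step_GD (t c) (b c)) N0 (\<lambda>p q. C * vac p q))"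
    unfolding window_def C_def
    by (intro intertwined_evolve intertwined_right_vector assms(1,2) ne)
  from intertwinedD(1)[OF this]
  have "left_functional (window (\<lambda>c. step_DG (t c) (b c)) N0 right_vector) =
    x * (C * window (\<lambda>c. step_GD (t c) (b c)) N0 vac dvac gvac)"
    unfolding left_functional_def window_def evolve_GD_scale by simp
  then have "left_functional (window (\<lambda>c. step_DG (t c) (b c)) N0 right_vector) / (x * (1 - x ^ n)) =
    (1 - v * x ^ n) * (1 - v ^ n * x ^ n) / ((1 - x ^ n) * (1 - v ^ (n + 1) * x ^ n)) *
    window (\<lambda>c. step_GD (t c) (b c)) N0 vac dvac gvac"
    using x_nonzero by (simp add: C_def mult.commute)
  with window_limit[OF assms(3) u, of N0 t b] assms(5,6) show ?thesis by simp
qed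

end

section \<open>Rows as sums over paths\<close>

definition spin_of :: "int set \<Rightarrow> int \<Rightarrow> spin" where
  "spin_of M c = (if c \<in> M then SMinus else SPlus)"

definition charge :: "spin \<Rightarrow> int" where
  "charge s = (if s = SMinus then 1 else 0)"

text \<open>Partition function of a finite row whose rightmost edge is pinned to \<open>e\<close>,
  as a function of its leftmost edge.\<close>

definition row_value ::
  "nat \<Rightarrow> vertex_weight \<Rightarrow> dspin \<Rightarrow> (int \<Rightarrow> spin) \<Rightarrow> (int \<Rightarrow> spin) \<Rightarrow> int \<Rightarrow> nat \<Rightarrow> dspin \<Rightarrow> complex" where
  "row_value n W e t b c k = evolve (\<lambda>i. row_step n W (t i) (b i)) c k (\<lambda>p. if p = e then 1 else 0)"

lemma row_value_0 [simp]: "row_value n W e t b c 0 p = (if p = e then 1 else 0)"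
  by (simp add: row_value_def)

lemma row_value_Suc: "row_value n W e t b c (Suc k) p =
  row_step n W (t (c + int (Suc k))) (b (c + int (Suc k))) (row_value n W e t b c k) p"
  by (simp add: row_value_def algebra_simps)

lemma row_value_cong:
  assumes "\<And>i. i \<in> {c<..c + int k} \<Longrightarrow> t i = t' i" "\<And>i. i \<in> {c<..c + int k} \<Longrightarrow> b i = b' i"
  shows "row_value n W e t b c k = row_value n W e t' b' c k"
  unfolding row_value_def by (rule evolve_cong) (use assms in auto)

text \<open>Finiteness provides an edge \<open>B\<close> beyond all exceptions, and from there
  \<open>e\<close> spreads to the right down to column \<open>N\<close>.\<close>

lemma finite_support_left:
  fixes s :: "int \<Rightarrow> 'a"
  assumes fin: "finite {c. s c \<noteq> e}"
    and step: "\<And>c. c > N \<Longrightarrow> s c = e \<Longrightarrow> s (c - 1) = e"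
    and "c \<ge> N"
  shows "s c = e"
proof -
  define B where "B = (\<Sum>c | s c \<noteq> e. \<bar>c\<bar>) + \<bar>c\<bar> + 1"
  have "s B = e"
  proof (rule ccontr)
    assume "s B \<noteq> e"
    then have "\<bar>B\<bar> \<le> (\<Sum>c | s c \<noteq> e. \<bar>c\<bar>)" using fin by (intro member_le_sum) auto
    then show False by (simp add: B_def)
  qed
  have "(\<Sum>c | s c \<noteq> e. \<bar>c\<bar>) \<ge> 0" by (simp add: sum_nonneg)
  then have "c \<le> B" unfolding B_def by linarith
  then have "N \<le> c \<longrightarrow> s c = e"
  proof (induction c rule: int_le_induct)
    case base
    then show ?case using \<open>s B = e\<close> by simp
  next
    case (step c)
    then show ?case using assms(2)[of c] by simp
  qed
  with assms(3) show ?thesis by simp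
qed

lemma finite_support_right:
  fixes s :: "int \<Rightarrow> 'a"
  assumes fin: "finite {c. s c \<noteq> e}"
    and step: "\<And>c. c < N \<Longrightarrow> s c = e \<Longrightarrow> s (c + 1) = e"
    and "c \<le> N"
  shows "s c = e"
proof -
  have "(s \<circ> uminus) (- c) = e"
  proof (rule finite_support_left)
    have "{c. (s \<circ> uminus) c \<noteq> e} = uminus ` {c. s c \<noteq> e}"
      by (auto simp: image_iff) (metis minus_minus)
    then show "finite {c. (s \<circ> uminus) c \<noteq> e}" using fin by simp
    show "(s \<circ> uminus) (c - 1) = e" if "c > - N" "(s \<circ> uminus) c = e" for c
      using step[of "- c"] that by simp
    show "- N \<le> - c" using assms(3) by simp
  qed
  then show ?thesis by simp
qed

lemma interval_Suc: "{c<..c + int (Suc k)} = insert (c + int (Suc k)) {c<..c + int k}"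
  by auto

text \<open>\<open>M\<close> is the set of columns where the vertical spin between the two rows is
  minus. Each pair step decides one more column, so the induction splits the subsets by whether they
  contain it.\<close>

lemma pair_value:
  "evolve (\<lambda>i. pair_step n W1 W2 (t i) (b i)) c k
      (\<lambda>p1 p2. (if p1 = e1 then 1 else 0) * (if p2 = e2 then 1 else 0)) p1 p2 =
   (\<Sum>M\<in>Pow {c<..c + int k}. row_value n W1 e1 t (spin_of M) c k p1 * row_value n W2 e2 (spin_of M) b c k p2)"
proof (induction k arbitrary: p1 p2)
  case (Suc k)
  define i where "i = c + int (Suc k)"
  define I where "I = {c<..c + int k}"
  define f1 where "f1 = (\<lambda>M. row_value n W1 e1 t (spin_of M) c k)"
  define f2 where "f2 = (\<lambda>M. row_value n W2 e2 (spin_of M) b c k)"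
  have fin: "finite I" and iI: "i \<notin> I" by (auto simp: I_def i_def)
  define h where "h = (\<lambda>M s. row_step n W1 (t i) s (f1 M) p1 * row_step n W2 s (b i) (f2 M) p2)"
  have "(\<Sum>M\<in>Pow {c<..c + int (Suc k)}. row_value n W1 e1 t (spin_of M) c (Suc k) p1 *
        row_value n W2 e2 (spin_of M) b c (Suc k) p2) =
     (\<Sum>M\<in>Pow (insert i I). h M (spin_of M i))"
    unfolding interval_Suc row_value_Suc h_def f1_def f2_def i_def I_def ..
  also have "\<dots> = (\<Sum>M\<in>Pow I. h M (spin_of M i)) + (\<Sum>M\<in>insert i ` Pow I. h M (spin_of M i))"
    unfolding Pow_insert using fin iI by (intro sum.union_disjoint) auto
  also have "(\<Sum>M\<in>insert i ` Pow I. h M (spin_of M i)) = (\<Sum>M\<in>Pow I. h (insert i M) (spin_of (insert i M) i))"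
    using iI by (subst sum.reindex) (auto simp: inj_on_def)
  also have "\<dots> = (\<Sum>M\<in>Pow I. h M SMinus)"
  proof (rule sum.cong)
    fix M assume "M \<in> Pow I"
    have "f1 (insert i M) = f1 M" "f2 (insert i M) = f2 M"
      unfolding f1_def f2_def by (rule row_value_cong; use iI in \<open>auto simp: spin_of_def I_def\<close>)+
    then show "h (insert i M) (spin_of (insert i M) i) = h M SMinus"
      by (simp add: h_def spin_of_def)
  qed simp
  also have "(\<Sum>M\<in>Pow I. h M (spin_of M i)) = (\<Sum>M\<in>Pow I. h M SPlus)"
    using iI by (intro sum.cong) (auto simp: spin_of_def)
  also have "(\<Sum>M\<in>Pow I. h M SPlus) + (\<Sum>M\<in>Pow I. h M SMinus) = (\<Sum>s\<in>{SPlus, SMinus}. \<Sum>M\<in>Pow I. h M s)"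
    by simp
  also have "\<dots> = pair_step n W1 W2 (t i) (b i) (\<lambda>q1 q2. \<Sum>M\<in>Pow I. f1 M q1 * f2 M q2) p1 p2"
    unfolding pair_step_def
  proof (rule sum.cong)
    fix s
    have "row_step n W1 (t i) s (\<lambda>q1. row_step n W2 s (b i) (\<lambda>q2. \<Sum>M\<in>Pow I. f1 M q1 * f2 M q2) p2) p1
      = (\<Sum>q1\<in>edge_states n. \<Sum>q2\<in>edge_states n. \<Sum>M\<in>Pow I.
          (weight_val W1 p1 (t i) q1 s * f1 M q1) * (weight_val W2 p2 s q2 (b i) * f2 M q2))"
      unfolding row_step_def by (simp add: sum_distrib_left mult_ac)
    also have "\<dots> = (\<Sum>q1\<in>edge_states n. \<Sum>M\<in>Pow I. \<Sum>q2\<in>edge_states n.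
          (weight_val W1 p1 (t i) q1 s * f1 M q1) * (weight_val W2 p2 s q2 (b i) * f2 M q2))"
      by (intro sum.cong refl sum.swap)
    also have "\<dots> = (\<Sum>M\<in>Pow I. \<Sum>q1\<in>edge_states n. \<Sum>q2\<in>edge_states n.
          (weight_val W1 p1 (t i) q1 s * f1 M q1) * (weight_val W2 p2 s q2 (b i) * f2 M q2))"
      by (rule sum.swap)
    also have "\<dots> = (\<Sum>M\<in>Pow I. h M s)"
      unfolding h_def row_step_def sum_product ..
    finally show "(\<Sum>M\<in>Pow I. h M s) = row_step n W1 (t i) s (\<lambda>q1. row_step n W2 s (b i) (\<lambda>q2. \<Sum>M\<in>Pow I. f1 M q1 * f2 M q2) p2) p1" ..
  qed simp
  also have "\<dots> = evolve (\<lambda>i. pair_step n W1 W2 (t i) (b i)) c (Suc k)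
      (\<lambda>p1 p2. (if p1 = e1 then 1 else 0) * (if p2 = e2 then 1 else 0)) p1 p2"
  proof -
    have "(\<lambda>q1 q2. \<Sum>M\<in>Pow I. f1 M q1 * f2 M q2) = evolve (\<lambda>i. pair_step n W1 W2 (t i) (b i)) c k
      (\<lambda>p1 p2. (if p1 = e1 then 1 else 0) * (if p2 = e2 then 1 else 0))"
      unfolding I_def f1_def f2_def by (intro ext) (rule Suc.IH[symmetric])
    then show ?thesis by (simp add: i_def algebra_simps)
  qed
  finally show ?case ..
qed simp

definition trivial_outside :: "int \<Rightarrow> nat \<Rightarrow> (int \<Rightarrow> int) \<Rightarrow> bool" where
  "trivial_outside m N \<zeta> \<longleftrightarrow> (\<forall>c. c > int N \<longrightarrow> column_spin m \<zeta> c = SPlus) \<and>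
     (\<forall>c. c < - int N \<longrightarrow> column_spin m \<zeta> c = SMinus)"

text \<open>What Delta and Gamma ice share: the vacuum edge spreads to the right through empty
  columns and to the left through occupied ones, with weight 1, and every vertex conserves the
  number of minus spins.\<close>

locale row_model =
  fixes n :: nat and W :: vertex_weight and e :: dspin
  assumes e_state: "e \<in> edge_states n"
    and W_plus: "W e SPlus e SPlus = Some 1" and W_minus: "W e SMinus e SMinus = Some 1"
    and W_left: "\<And>r. W e SPlus r SPlus \<noteq> None \<Longrightarrow> r = e"
    and W_right: "\<And>l. W l SMinus e SMinus \<noteq> None \<Longrightarrow> l = e"
    and W_charge: "\<And>l t r b. W l t r b \<noteq> None \<Longrightarrow>
      charge (fst l) + charge t = charge (fst r) + charge b"
begin

text \<open>Later this excludes middle rows whose number of minus spins in the window does not fit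
  the charge \<open>m\<close>.\<close>

lemma row_value_charge:
  assumes "row_value n W e t b c k p \<noteq> 0"
  shows "charge (fst p) + (\<Sum>i\<in>{c<..c + int k}. charge (t i)) =
    charge (fst e) + (\<Sum>i\<in>{c<..c + int k}. charge (b i))"
  using assms
proof (induction k arbitrary: p)
  case 0
  then show ?case by (auto split: if_splits)
next
  case (Suc k)
  define i where "i = c + int (Suc k)"
  have "(\<Sum>q\<in>edge_states n. weight_val W p (t i) q (b i) * row_value n W e t b c k q) \<noteq> 0"
    using Suc.prems unfolding row_value_Suc row_step_def i_def .
  then obtain q where "weight_val W p (t i) q (b i) * row_value n W e t b c k q \<noteq> 0"
    by (rule sum.not_neutral_contains_not_neutral)
  then have q: "weight_val W p (t i) q (b i) \<noteq> 0" "row_value n W e t b c k q \<noteq> 0"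
    by auto
  from q(1) have "W p (t i) q (b i) \<noteq> None"
    by (auto simp: weight_val_def split: option.splits)
  note IH = W_charge[OF this] Suc.IH[OF q(2)]
  have sum: "(\<Sum>j\<in>{c<..c + int (Suc k)}. f j) = f i + (\<Sum>j\<in>{c<..c + int k}. f j)"
    for f :: "int \<Rightarrow> int"
    unfolding interval_Suc i_def by (rule sum.insert) auto
  show ?case using IH unfolding sum by linarith
qed

text \<open>Padding with \<open>e\<close> outside the interval makes a path a candidate state of the
  infinite row, so that paths and admissible states can be compared as sets.\<close>

definition paths :: "int \<Rightarrow> nat \<Rightarrow> dspin \<Rightarrow> (int \<Rightarrow> dspin) set" where
  "paths c k p = {s. s (c + int k) = p \<and> (\<forall>i. i \<le> c \<or> i > c + int k \<longrightarrow> s i = e) \<and>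
     (\<forall>i. s i \<in> edge_states n)}"

definition path_weight where
  "path_weight t b c k s = (\<Prod>i\<in>{c<..c + int k}. weight_val W (s i) (t i) (s (i - 1)) (b i))"

lemma finite_paths: "finite (paths c k p)"
proof -
  define S where "S = {s :: int \<Rightarrow> dspin. \<forall>i. (i \<in> {c<..c + int k} \<longrightarrow> s i \<in> edge_states n) \<and>
    (i \<notin> {c<..c + int k} \<longrightarrow> s i = e)}"
  have "finite S"
    unfolding S_def by (rule finite_set_of_finite_funs) (rule finite_greaterThanAtMost_int finite_edge_states)+
  moreover have "s \<in> S" if "s \<in> paths c k p" for s
  proof -
    have "s i \<in> edge_states n" for i
      using that unfolding paths_def by blast
    moreover have "s i = e" if "i \<notin> {c<..c + int k}" for i
    proof -
      have "i \<le> c \<or> i > c + int k" using that by auto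
      then show ?thesis using \<open>s \<in> paths c k p\<close> unfolding paths_def by blast
    qed
    ultimately show ?thesis unfolding S_def by blast
  qed
  ultimately show ?thesis by (meson finite_subset subsetI)
qed

lemma path_sum:
  assumes "p \<in> edge_states n"
  shows "(\<Sum>s\<in>paths c k p. path_weight t b c k s) = row_value n W e t b c k p"
  using assms
proof (induction k arbitrary: p)
  case 0
  have "paths c 0 p = (if p = e then {\<lambda>_. e} else {})"
  proof -
    have sub: "s = (\<lambda>_. e) \<and> p = e" if "s \<in> paths c 0 p" for s
    proof -
      have "i \<le> c \<or> i > c + int 0" for i by auto
      then have "s i = e" for i using that unfolding paths_def by blast
      moreover have "s (c + int 0) = p" using that unfolding paths_def by blast
      ultimately show ?thesis by (metis ext)
    qed
    have mem: "(\<lambda>_. e) \<in> paths c 0 e" using e_state unfolding paths_def by blast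
    show ?thesis
    proof (cases "p = e")
      case True
      have "paths c 0 p = {\<lambda>_. e}" using sub mem True by blast
      then show ?thesis using True by simp
    next
      case False
      then have "paths c 0 p = {}" using sub by blast
      then show ?thesis using False by simp
    qed
  qed
  then show ?case by (cases "p = e") (simp_all add: path_weight_def)
next
  case (Suc k)
  define i where "i = c + int (Suc k)"
  define V where "V = (\<lambda>q. weight_val W p (t i) q (b i))"
  have P: "s \<in> paths c (Suc k) p \<longleftrightarrow>
      s i = p \<and> (\<forall>j. j \<le> c \<or> j > i \<longrightarrow> s j = e) \<and> (\<forall>j. s j \<in> edge_states n)" for s
    unfolding paths_def i_def by blast
  have i: "i - 1 = c + int k" "\<And>j. j > c + int k \<longleftrightarrow> j \<ge> i" "\<not> i \<le> c"
    by (auto simp: i_def)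
  have Q: "s \<in> paths c k q \<longleftrightarrow>
      s (i - 1) = q \<and> (\<forall>j. j \<le> c \<or> j \<ge> i \<longrightarrow> s j = e) \<and> (\<forall>j. s j \<in> edge_states n)" for s q
    unfolding paths_def i by blast
  have "row_value n W e t b c (Suc k) p = (\<Sum>q\<in>edge_states n. V q * row_value n W e t b c k q)"
    by (simp add: row_value_Suc row_step_def V_def i_def)
  also have "\<dots> = (\<Sum>q\<in>edge_states n. \<Sum>s\<in>paths c k q. V q * path_weight t b c k s)"
    by (intro sum.cong refl) (simp only: Suc.IH[symmetric] sum_distrib_left)
  also have "\<dots> = (\<Sum>(q, s)\<in>Sigma (edge_states n) (paths c k). V q * path_weight t b c k s)"
    by (rule sum.Sigma) (simp_all add: finite_paths)
  also have "\<dots> = (\<Sum>s\<in>paths c (Suc k) p. path_weight t b c (Suc k) s)"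
  \<comment> \<open>A path through one more column is a shorter path whose padding at the new left
    edge is overwritten by \<open>p\<close>; restoring \<open>e\<close> there is the
    inverse.\<close>
  proof (rule sum.reindex_bij_witness[where j = "\<lambda>(q, s). s(i := p)" and i = "\<lambda>s. (s (i - 1), s(i := e))"], goal_cases)
    case (1 a)
    obtain q s where a: "a = (q, s)" "s \<in> paths c k q" using 1 by auto
    then have "s i = e" "s (i - 1) = q" by (auto simp: Q)
    then show ?case by (simp add: a fun_upd_idem)
  next
    case (2 a)
    obtain q s where a: "a = (q, s)" "s \<in> paths c k q" using 2 by auto
    show ?case unfolding a prod.case P using a(2) Suc.prems i(3) unfolding Q by simp
  next
    case (3 s)
    then have "s i = p" by (simp add: P)
    then show ?case by (simp add: fun_upd_idem)
  next
    case (4 s)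
    then have "s(i := e) \<in> paths c k (s (i - 1))" unfolding P Q using e_state by simp
    moreover have "s (i - 1) \<in> edge_states n" using 4 by (simp add: P)
    ultimately show ?case by simp
  next
    case (5 a)
    obtain q s where a: "a = (q, s)" "s \<in> paths c k q" using 5 by auto
    have "path_weight t b c (Suc k) (s(i := p)) =
      weight_val W p (t i) (s (i - 1)) (b i) *
      (\<Prod>j\<in>{c<..c + int k}. weight_val W ((s(i := p)) j) (t j) ((s(i := p)) (j - 1)) (b j))"
    proof -
      have "{c<..c + int (Suc k)} = insert i {c<..c + int k}" "i \<notin> {c<..c + int k}"
        unfolding i_def by auto
      then show ?thesis unfolding path_weight_def by simp
    qed
    also have "(\<Prod>j\<in>{c<..c + int k}. weight_val W ((s(i := p)) j) (t j) ((s(i := p)) (j - 1)) (b j)) =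
      path_weight t b c k s"
      unfolding path_weight_def
    proof (rule prod.cong)
      fix j assume "j \<in> {c<..c + int k}"
      then have "j \<noteq> i" "j - 1 \<noteq> i" by (auto simp: i_def)
      then show "weight_val W ((s(i := p)) j) (t j) ((s(i := p)) (j - 1)) (b j) =
        weight_val W (s j) (t j) (s (j - 1)) (b j)" by simp
    qed simp
    also have "s (i - 1) = q" using a by (simp add: Q)
    finally show ?case by (simp only: a V_def prod.case)
  qed
  finally show ?case ..
qed

lemma admissible_left:
  assumes s: "s \<in> admissible_states n W e m \<eta> \<xi>"
    and "\<And>c. c > N \<Longrightarrow> column_spin m \<eta> c = SPlus" "\<And>c. c > N \<Longrightarrow> column_spin m \<xi> c = SPlus"
    and "c \<ge> N"
  shows "s c = e"
proof (rule finite_support_left)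
  show "finite {c. s c \<noteq> e}" using s by (simp add: admissible_states_def)
  fix c assume c: "c > N" "s c = e"
  have "vertex_at W m \<eta> \<xi> s c \<noteq> None" using s by (simp add: admissible_states_def)
  then show "s (c - 1) = e"
    using W_left[of "s (c - 1)"] c assms(2,3)[of c] by (simp add: vertex_at_def)
qed fact

lemma admissible_right:
  assumes s: "s \<in> admissible_states n W e m \<eta> \<xi>"
    and "\<And>c. c \<le> N \<Longrightarrow> column_spin m \<eta> c = SMinus" "\<And>c. c \<le> N \<Longrightarrow> column_spin m \<xi> c = SMinus"
    and "c \<le> N"
  shows "s c = e"
proof (rule finite_support_right)
  show "finite {c. s c \<noteq> e}" using s by (simp add: admissible_states_def)
  fix c assume c: "c < N" "s c = e"
  have "vertex_at W m \<eta> \<xi> s (c + 1) \<noteq> None" using s by (simp add: admissible_states_def)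
  then show "s (c + 1) = e"
    using W_right[of "s (c + 1)"] c assms(2,3)[of "c + 1"] by (simp add: vertex_at_def)
qed fact

lemma row_coeff_nonzeroE:
  assumes "row_coeff n W e m \<eta> \<xi> \<noteq> 0"
  obtains s where "s \<in> admissible_states n W e m \<eta> \<xi>"
  using assms unfolding row_coeff_def by (rule sum.not_neutral_contains_not_neutral)

text \<open>If the vacuum edge cannot turn a plus above into a minus below, it survives from the far
  left down to column \<open>N\<close>, and no minus appears on the way. Delta ice satisfies this;
  the mirrored lemma serves Gamma ice on the right.\<close>

lemma row_coeff_support_left:
  assumes "row_coeff n W e m \<eta> \<xi> \<noteq> 0"
    and create: "\<And>r. W e SPlus r SMinus = None"
    and plus: "\<And>c. c > N \<Longrightarrow> column_spin m \<xi> c = SPlus"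
    and "c > N"
  shows "column_spin m \<eta> c = SPlus"
proof -
  obtain s where s: "s \<in> admissible_states n W e m \<eta> \<xi>"
    using row_coeff_nonzeroE[OF assms(1)] .
  have vert: "W (s c) (column_spin m \<xi> c) (s (c - 1)) (column_spin m \<eta> c) \<noteq> None" for c
    using s by (simp add: admissible_states_def vertex_at_def)
  have eta: "column_spin m \<eta> c = SPlus" if "c > N" "s c = e" for c
    using vert[of c] that plus create[of "s (c - 1)"] by (cases "column_spin m \<eta> c") auto
  have "s c = e"
  proof (rule finite_support_left)
    show "finite {c. s c \<noteq> e}" using s by (simp add: admissible_states_def)
    show "s (c - 1) = e" if "c > N" "s c = e" for c
      using vert[of c] eta[OF that] that plus[OF that(1)] W_left[of "s (c - 1)"] by simp
    show "N \<le> c" using assms(4) by simp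
  qed
  then show ?thesis using eta assms(4) by blast
qed

lemma row_coeff_support_right:
  assumes "row_coeff n W e m \<eta> \<xi> \<noteq> 0"
    and create: "\<And>l. W l SPlus e SMinus = None"
    and minus: "\<And>c. c < N \<Longrightarrow> column_spin m \<eta> c = SMinus"
    and "c < N"
  shows "column_spin m \<xi> c = SMinus"
proof -
  obtain s where s: "s \<in> admissible_states n W e m \<eta> \<xi>"
    using row_coeff_nonzeroE[OF assms(1)] .
  have vert: "W (s c) (column_spin m \<xi> c) (s (c - 1)) (column_spin m \<eta> c) \<noteq> None" for c
    using s by (simp add: admissible_states_def vertex_at_def)
  have xi: "column_spin m \<xi> c = SMinus" if "c < N" "s (c - 1) = e" for c
    using vert[of c] that minus create[of "s c"] by (cases "column_spin m \<xi> c") auto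
  have "s (c - 1) = e"
  proof (rule finite_support_right)
    show "finite {c. s c \<noteq> e}" using s by (simp add: admissible_states_def)
    show "s (c + 1) = e" if "c < N - 1" "s c = e" for c
      using vert[of "c + 1"] xi[of "c + 1"] that minus[of "c + 1"] W_right[of "s (c + 1)"] by simp
    show "c - 1 \<le> N - 1" using assms(4) by simp
  qed
  then show ?thesis using xi assms(4) by blast
qed

lemma row_coeff_window:
  assumes triv: "trivial_outside m N \<eta>" "trivial_outside m N \<xi>"
  shows "row_coeff n W e m \<eta> \<xi> =
    row_value n W e (column_spin m \<xi>) (column_spin m \<eta>) (- int N - 1) (2 * N + 1) e"
proof -
  let ?A = "admissible_states n W e m \<eta> \<xi>" and ?P = "paths (- int N - 1) (2 * N + 1) e"
  let ?w = "path_weight (column_spin m \<xi>) (column_spin m \<eta>) (- int N - 1) (2 * N + 1)"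
  have N: "- int N - 1 + int (2 * N + 1) = int N" by simp
  have sub: "?A \<subseteq> ?P"
  proof
    fix s assume s: "s \<in> ?A"
    then have "\<forall>i. s i \<in> edge_states n"
      using spin.exhaust by (auto simp: admissible_states_def edge_states_def mem_Times_iff)
    moreover have "s i = e" if "i \<ge> int N" for i
      by (rule admissible_left[OF s _ _ that]) (use triv in \<open>auto simp: trivial_outside_def\<close>)
    moreover have "s i = e" if "i \<le> - int N - 1" for i
      by (rule admissible_right[OF s _ _ that]) (use triv in \<open>auto simp: trivial_outside_def\<close>)
    ultimately show "s \<in> ?P" unfolding paths_def N by auto
  qed
  have P_out: "s i = e" if "s \<in> ?P" "i \<ge> int N \<or> i \<le> - int N - 1" for s i
    using that unfolding paths_def N by (cases "i = int N") auto
  have outside: "vertex_at W m \<eta> \<xi> s c = Some 1" if "s \<in> ?P" "c \<notin> {- int N - 1<..int N}" for s c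
  proof (cases "c > int N")
    case True
    then have "column_spin m \<eta> c = SPlus" "column_spin m \<xi> c = SPlus"
      using triv by (auto simp: trivial_outside_def)
    moreover have "s c = e" "s (c - 1) = e"
      using P_out[OF that(1)] True by auto
    ultimately show ?thesis by (simp add: vertex_at_def W_plus)
  next
    case False
    then have c: "c < - int N" using that(2) by auto
    then have "column_spin m \<eta> c = SMinus" "column_spin m \<xi> c = SMinus"
      using triv by (auto simp: trivial_outside_def)
    moreover have "s c = e" "s (c - 1) = e"
      using P_out[OF that(1)] c by auto
    ultimately show ?thesis by (simp add: vertex_at_def W_minus)
  qed
  \<comment> \<open>A path that is no admissible state meets a forbidden vertex, to which
    \<open>weight_val\<close> gives the value 0. Such paths can therefore be added to the
    sum.\<close>
  have zero: "?w s = 0" if s: "s \<in> ?P - ?A" for s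
  proof -
    have "finite {c. s c \<noteq> e}"
    proof (rule finite_subset)
      show "{c. s c \<noteq> e} \<subseteq> {- int N - 1..int N}"
      proof
        fix c assume "c \<in> {c. s c \<noteq> e}"
        then show "c \<in> {- int N - 1..int N}"
          using P_out[of s c] s by (cases "c \<ge> int N \<or> c \<le> - int N - 1") auto
      qed
    qed simp
    moreover have "\<forall>c. snd (s c) \<in> {0..<int n}"
      using s by (auto simp: paths_def edge_states_def mem_Times_iff)
    ultimately obtain c where c: "vertex_at W m \<eta> \<xi> s c = None"
      using s by (auto simp: admissible_states_def)
    then have "c \<in> {- int N - 1<..int N}" using outside[of s c] s by force
    moreover have "weight_val W (s c) (column_spin m \<xi> c) (s (c - 1)) (column_spin m \<eta> c) = 0"
      using c by (simp add: vertex_at_def weight_val_def)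
    ultimately show ?thesis unfolding path_weight_def N by (intro prod_zero) auto
  qed
  have weight: "(\<Prod>c | the (vertex_at W m \<eta> \<xi> s c) \<noteq> 1. the (vertex_at W m \<eta> \<xi> s c)) = ?w s"
    if s: "s \<in> ?A" for s
  proof -
    have v: "the (vertex_at W m \<eta> \<xi> s c) = weight_val W (s c) (column_spin m \<xi> c) (s (c - 1)) (column_spin m \<eta> c)" for c
    proof -
      obtain y where "vertex_at W m \<eta> \<xi> s c = Some y"
        using s by (auto simp: admissible_states_def)
      then show ?thesis by (simp add: vertex_at_def weight_val_def)
    qed
    have "(\<Prod>c | the (vertex_at W m \<eta> \<xi> s c) \<noteq> 1. the (vertex_at W m \<eta> \<xi> s c)) =
      (\<Prod>c\<in>{- int N - 1<..int N}. the (vertex_at W m \<eta> \<xi> s c))"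
    proof (rule prod.mono_neutral_left)
      show "{c. the (vertex_at W m \<eta> \<xi> s c) \<noteq> 1} \<subseteq> {- int N - 1<..int N}"
      proof
        fix c assume "c \<in> {c. the (vertex_at W m \<eta> \<xi> s c) \<noteq> 1}"
        then show "c \<in> {- int N - 1<..int N}"
          using outside[of s c] s sub by (cases "c \<in> {- int N - 1<..int N}") (auto simp del: greaterThanAtMost_iff)
      qed
    qed auto
    then show ?thesis unfolding path_weight_def N v .
  qed
  have "row_coeff n W e m \<eta> \<xi> = (\<Sum>s\<in>?A. ?w s)"
    unfolding row_coeff_def by (rule sum.cong) (use weight in auto)
  also have "\<dots> = (\<Sum>s\<in>?P. ?w s)"
    by (rule sum.mono_neutral_left) (use finite_paths sub zero in auto)
  also have "\<dots> = row_value n W e (column_spin m \<xi>) (column_spin m \<eta>) (- int N - 1) (2 * N + 1) e"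
    by (rule path_sum) (rule e_state)
  finally show ?thesis .
qed

end

lemma row_model_delta:
  assumes "n \<ge> 1"
  shows "row_model n (delta_weight n v g z) (SPlus, 0)"
proof
  fix l t r b
  assume a: "delta_weight n v g z l t r b \<noteq> None"
  obtain l1 l2 r1 r2 where lr: "l = (l1, l2)" "r = (r1, r2)" by (cases l, cases r)
  show "charge (fst l) + charge t = charge (fst r) + charge b"
    using a unfolding lr by (cases l1; cases t; cases r1; cases b) (auto simp: charge_def)
next
  fix r
  assume a: "delta_weight n v g z (SPlus, 0) SPlus r SPlus \<noteq> None"
  obtain r1 r2 where lr: "r = (r1, r2)" by (cases r)
  show "r = (SPlus, 0)" using a unfolding lr by (cases r1) (auto split: if_splits)
next
  fix r
  assume a: "delta_weight n v g z r SMinus (SPlus, 0) SMinus \<noteq> None"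
  obtain r1 r2 where lr: "r = (r1, r2)" by (cases r)
  show "r = (SPlus, 0)" using a unfolding lr by (cases r1) (auto split: if_splits)
qed (use assms in \<open>auto simp: edge_states_def\<close>)

lemma row_model_gamma:
  assumes "n \<ge> 1"
  shows "row_model n (gamma_weight n v g z) (SMinus, 0)"
proof
  fix l t r b
  assume a: "gamma_weight n v g z l t r b \<noteq> None"
  obtain l1 l2 r1 r2 where lr: "l = (l1, l2)" "r = (r1, r2)" by (cases l, cases r)
  show "charge (fst l) + charge t = charge (fst r) + charge b"
    using a unfolding lr by (cases l1; cases t; cases r1; cases b) (auto simp: charge_def)
next
  fix r
  assume a: "gamma_weight n v g z (SMinus, 0) SPlus r SPlus \<noteq> None"
  obtain r1 r2 where lr: "r = (r1, r2)" by (cases r)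
  show "r = (SMinus, 0)" using a unfolding lr by (cases r1) (auto split: if_splits)
next
  fix r
  assume a: "gamma_weight n v g z r SMinus (SMinus, 0) SMinus \<noteq> None"
  obtain r1 r2 where lr: "r = (r1, r2)" by (cases r)
  show "r = (SMinus, 0)" using a unfolding lr by (cases r1) (auto split: if_splits)
qed (use assms in \<open>auto simp: edge_states_def\<close>)

section \<open>Windows of the Fock basis\<close>

definition fock_window :: "int \<Rightarrow> nat \<Rightarrow> (int \<Rightarrow> int) set" where
  "fock_window m N = {\<zeta> \<in> fock_basis m. trivial_outside m N \<zeta>}"

definition window_part :: "int \<Rightarrow> nat \<Rightarrow> (int \<Rightarrow> int) \<Rightarrow> int set" where
  "window_part m N \<zeta> = \<zeta> ` {..m} \<inter> {- int N - 1<..int N}"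

lemma column_spin_iff: "column_spin m \<zeta> c = SMinus \<longleftrightarrow> c \<in> \<zeta> ` {..m}"
  "column_spin m \<zeta> c = SPlus \<longleftrightarrow> c \<notin> \<zeta> ` {..m}"
  by (auto simp: column_spin_def)

lemma fock_strict: "\<zeta> \<in> fock_basis m \<Longrightarrow> j < k \<Longrightarrow> k \<le> m \<Longrightarrow> \<zeta> j < \<zeta> k"
  by (auto simp: fock_basis_def strict_mono_on_def)

lemma fock_less_iff: "\<zeta> \<in> fock_basis m \<Longrightarrow> j \<le> m \<Longrightarrow> k \<le> m \<Longrightarrow> \<zeta> j < \<zeta> k \<longleftrightarrow> j < k"
  using fock_strict[of \<zeta> m j k] fock_strict[of \<zeta> m k j] by (cases j k rule: linorder_cases) auto

lemma fock_eventually: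
  assumes "\<zeta> \<in> fock_basis m"
  obtains K where "K \<le> m" "\<And>k. k \<le> K \<Longrightarrow> \<zeta> k = k"
proof -
  from assms obtain K where "\<forall>k\<le>K. \<zeta> k = k"
    by (auto simp: fock_basis_def eventually_at_bot_linorder)
  then show ?thesis using that[of "min K m"] by simp
qed

lemma fock_defect_mono:
  assumes "\<zeta> \<in> fock_basis m" "j \<le> k" "k \<le> m"
  shows "\<zeta> j - j \<le> \<zeta> k - k"
  using assms(2,3)
proof (induction k rule: int_ge_induct)
  case (step k)
  then have "\<zeta> k < \<zeta> (k + 1)" using fock_strict[OF assms(1), of k "k + 1"] by simp
  with step show ?case by simp
qed simp

lemma fock_ge:
  assumes "\<zeta> \<in> fock_basis m" "k \<le> m"
  shows "k \<le> \<zeta> k"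
proof -
  obtain K where K: "\<And>k. k \<le> K \<Longrightarrow> \<zeta> k = k" using fock_eventually[OF assms(1)] by blast
  show ?thesis
    using fock_defect_mono[OF assms(1), of "min K k" k] K[of "min K k"] assms(2) by simp
qed

lemma fock_le_last: "\<zeta> \<in> fock_basis m \<Longrightarrow> k \<le> m \<Longrightarrow> \<zeta> k \<le> \<zeta> m"
  using fock_strict[of \<zeta> m k m] by (cases "k = m") auto

lemma trivial_outside_mono: "trivial_outside m N \<zeta> \<Longrightarrow> N \<le> N' \<Longrightarrow> trivial_outside m N' \<zeta>"
  by (simp add: trivial_outside_def)

lemma trivial_outsideI:
  assumes "\<zeta> \<in> fock_basis m" "\<And>k. k \<le> m \<Longrightarrow> k < - int N \<Longrightarrow> \<zeta> k = k" "- int N - 1 \<le> m" "\<zeta> m \<le> int N"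
  shows "trivial_outside m N \<zeta>"
  unfolding trivial_outside_def column_spin_iff
proof (intro conjI allI impI)
  fix c assume "c > int N"
  then show "c \<notin> \<zeta> ` {..m}" using fock_le_last[OF assms(1)] assms(4) by force
next
  fix c assume "c < - int N"
  then have "c \<le> m" "\<zeta> c = c" using assms(2)[of c] assms(3) by auto
  then show "c \<in> \<zeta> ` {..m}" by (metis atMost_iff image_eqI)
qed

lemma fock_trivial_outside:
  assumes "\<zeta> \<in> fock_basis m"
  obtains N where "trivial_outside m N \<zeta>"
proof -
  obtain K where K: "K \<le> m" "\<And>k. k \<le> K \<Longrightarrow> \<zeta> k = k" using fock_eventually[OF assms] by blast
  have "trivial_outside m (nat (\<bar>K\<bar> + \<bar>\<zeta> m\<bar> + \<bar>m\<bar>)) \<zeta>"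
    by (rule trivial_outsideI[OF assms]) (use K in auto)
  then show ?thesis by (rule that)
qed

text \<open>Upward induction from the range where \<open>\<zeta>\<close> is the identity: column
  \<open>k + 1\<close> is occupied by some index \<open>j > k\<close>, and
  \<open>j \<le> \<zeta> j = k + 1\<close> leaves only \<open>j = k + 1\<close>.\<close>

lemma trivial_outside_id:
  assumes "\<zeta> \<in> fock_basis m" "trivial_outside m N \<zeta>"
  shows "- int N - 1 \<le> m" and "k < - int N \<Longrightarrow> \<zeta> k = k"
proof -
  obtain K where K: "K \<le> m" "\<And>k. k \<le> K \<Longrightarrow> \<zeta> k = k" using fock_eventually[OF assms(1)] by blast
  have id: "k \<le> m \<and> \<zeta> k = k" if "k < - int N" for k
  proof (cases "k \<le> K")
    case True
    then show ?thesis using K by simp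
  next
    case False
    then have "K \<le> k" by simp
    then show ?thesis using that
    proof (induction k rule: int_ge_induct)
      case base
      then show ?case using K by simp
    next
      case (step k)
      then have k: "k \<le> m" "\<zeta> k = k" by auto
      from step.prems have "k + 1 \<in> \<zeta> ` {..m}"
        using assms(2) by (simp add: trivial_outside_def column_spin_iff)
      then obtain j where j: "j \<le> m" "\<zeta> j = k + 1" by auto
      then have "k < j" using fock_less_iff[OF assms(1), of k j] k by simp
      moreover have "j \<le> k + 1" using fock_ge[OF assms(1) j(1)] j(2) by simp
      ultimately have "j = k + 1" by simp
      with j show ?case by simp
    qed
  qed
  show "- int N - 1 \<le> m" using id[of "- int N - 1"] by simp
  show "\<zeta> k = k" if "k < - int N" using id that by simp
qed

section \<open>Fock vectors as subsets of a window\<close>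

lemma window_part_eq:
  assumes "\<zeta> \<in> fock_basis m" "trivial_outside m N \<zeta>"
  shows "window_part m N \<zeta> = \<zeta> ` {- int N..m}"
proof (intro equalityI subsetI)
  fix c assume "c \<in> window_part m N \<zeta>"
  then obtain k where k: "c = \<zeta> k" "k \<le> m" "c > - int N - 1" by (auto simp: window_part_def)
  then have "k \<ge> - int N" using trivial_outside_id(2)[OF assms, of k] by force
  then show "c \<in> \<zeta> ` {- int N..m}" using k by auto
next
  fix c assume "c \<in> \<zeta> ` {- int N..m}"
  then obtain k where k: "c = \<zeta> k" "- int N \<le> k" "k \<le> m" by auto
  then have "c \<ge> - int N" using fock_ge[OF assms(1), of k] by simp
  moreover have "c \<in> \<zeta> ` {..m}" using k by auto
  moreover from this have "c \<le> int N"
    using assms(2) unfolding trivial_outside_def column_spin_iff by (meson not_le)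
  ultimately show "c \<in> window_part m N \<zeta>" by (simp add: window_part_def)
qed

text \<open>The window sees exactly the indices from \<open>- N\<close> to \<open>m\<close>, so the
  charge appears as a particle number.\<close>

lemma card_window_part:
  assumes "\<zeta> \<in> fock_basis m" "trivial_outside m N \<zeta>"
  shows "int (card (window_part m N \<zeta>)) = m + int N + 1"
proof -
  have "inj_on \<zeta> {- int N..m}"
    using fock_less_iff[OF assms(1)] by (intro linorder_inj_onI') (metis atLeastAtMost_iff less_irrefl)
  then have "card (window_part m N \<zeta>) = card {- int N..m}"
    unfolding window_part_eq[OF assms] by (rule card_image)
  then show ?thesis using trivial_outside_id(1)[OF assms] by simp
qed

text \<open>The index \<open>j\<close> at which \<open>\<zeta>'\<close> takes the value
  \<open>\<zeta> k\<close> cannot lie below \<open>k\<close>, where both sequences agree. Used in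
  both directions, this is the inductive step for recovering a vector from its occupied
  columns.\<close>

lemma fock_image_le:
  assumes "\<zeta> \<in> fock_basis m" "\<zeta>' \<in> fock_basis m" "\<zeta> ` {..m} \<subseteq> \<zeta>' ` {..m}"
    and "k \<le> m" "\<And>j. j < k \<Longrightarrow> \<zeta> j = \<zeta>' j"
  shows "\<zeta>' k \<le> \<zeta> k"
proof -
  obtain j where j: "j \<le> m" "\<zeta> k = \<zeta>' j" using assms(3,4) by force
  have "\<not> j < k" using assms(5)[of j] j fock_strict[OF assms(1), of j k] assms(4) by auto
  then show ?thesis using fock_less_iff[OF assms(2) j(1) assms(4)] j by (metis not_le)
qed

lemma fock_eqI:
  assumes "\<zeta> \<in> fock_basis m" "\<zeta>' \<in> fock_basis m" "\<zeta> ` {..m} = \<zeta>' ` {..m}"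
  shows "\<zeta> = \<zeta>'"
proof -
  obtain K where K: "\<And>k. k \<le> K \<Longrightarrow> \<zeta> k = k" using fock_eventually[OF assms(1)] by blast
  obtain K' where K': "\<And>k. k \<le> K' \<Longrightarrow> \<zeta>' k = k" using fock_eventually[OF assms(2)] by blast
  define L where "L = min K K'"
  have "\<forall>j\<le>k. j \<le> m \<longrightarrow> \<zeta> j = \<zeta>' j" if "L \<le> k" for k
    using that
  proof (induction k rule: int_ge_induct)
    case base
    then show ?case using K K' by (simp add: L_def)
  next
    case (step k)
    have "\<zeta> (k + 1) = \<zeta>' (k + 1)" if "k + 1 \<le> m"
      using fock_image_le[OF assms(1,2) _ that] fock_image_le[OF assms(2,1) _ that] assms(3) step.IH that
      by (intro antisym) auto
    then show ?case using step.IH by (metis zle_add1_eq_le order_le_less)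
  qed
  then have "\<zeta> k = \<zeta>' k" if "k \<le> m" for k
    using that by (metis max.cobounded1 max.cobounded2)
  moreover have "\<zeta> \<in> extensional {..m}" "\<zeta>' \<in> extensional {..m}"
    using assms by (auto simp: fock_basis_def)
  ultimately show ?thesis by (metis atMost_iff extensionalityI)
qed

lemma fock_window_exists:
  assumes "M \<subseteq> {- int N - 1<..int N}" "int (card M) = m + int N + 1"
  shows "\<exists>\<zeta>\<in>fock_window m N. window_part m N \<zeta> = M"
proof -
  define L where "L = sorted_list_of_set M"
  have fin: "finite M" using assms(1) by (rule finite_subset) simp
  have len: "length L = nat (m + int N + 1)" and set: "set L = M"
    using assms(2) fin by (auto simp: L_def)
  have m: "- int N - 1 \<le> m" using assms(2) by linarith
  have L: "L ! i < L ! j" if "i < j" "j < length L" for i j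
    using that sorted_list_of_set.strict_sorted_key_list_of_set[of M]
    unfolding L_def[symmetric] by (simp add: sorted_wrt_nth_less)
  have mem: "L ! i \<in> M" if "i < length L" for i using that set by auto
  \<comment> \<open>Index \<open>- N\<close> receives the least element of \<open>M\<close>; all
    smaller indices are fixed, as they must be outside the window.\<close>
  define \<zeta> where "\<zeta> = (\<lambda>k. if k > m then undefined else if k < - int N then k else L ! nat (k + int N))"
  have low: "\<zeta> k = k" if "k < - int N" for k using that m by (simp add: \<zeta>_def)
  have high: "\<zeta> k = L ! nat (k + int N)" "nat (k + int N) < length L" if "- int N \<le> k" "k \<le> m" for k
    using that len by (auto simp: \<zeta>_def)
  have "strict_mono_on {..m} \<zeta>"
  proof (rule strict_mono_onI)
    fix j k assume jk: "j \<in> {..m}" "k \<in> {..m}" "j < k"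
    show "\<zeta> j < \<zeta> k"
    proof (cases "k < - int N")
      case True
      then show ?thesis using jk low by simp
    next
      case False
      then have k: "\<zeta> k = L ! nat (k + int N)" "nat (k + int N) < length L" using high jk by auto
      show ?thesis
      proof (cases "j < - int N")
        case True
        have "L ! nat (k + int N) > - int N - 1" using mem[OF k(2)] assms(1) by auto
        then show ?thesis using k low True by simp
      next
        case False
        then show ?thesis using high[of j] k L[of "nat (j + int N)" "nat (k + int N)"] jk by simp
      qed
    qed
  qed
  moreover have "\<forall>\<^sub>F k in at_bot. \<zeta> k = k"
    unfolding eventually_at_bot_linorder using low by (intro exI[of _ "- int N - 1"]) auto
  ultimately have basis: "\<zeta> \<in> fock_basis m"
    by (auto simp: fock_basis_def \<zeta>_def extensional_def)
  have last: "\<zeta> m \<le> int N"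
  proof (cases "m < - int N")
    case True
    then show ?thesis using low by simp
  next
    case False
    then show ?thesis using high[of m] mem[of "nat (m + int N)"] assms(1) by force
  qed
  have triv: "trivial_outside m N \<zeta>"
    by (rule trivial_outsideI[OF basis low m last])
  have "window_part m N \<zeta> \<subseteq> M"
  proof
    fix c assume "c \<in> window_part m N \<zeta>"
    then obtain k where "c = \<zeta> k" "- int N \<le> k" "k \<le> m"
      unfolding window_part_eq[OF basis triv] by auto
    then show "c \<in> M" using high[of k] mem by simp
  qed
  moreover have "card (window_part m N \<zeta>) = card M"
    using card_window_part[OF basis triv] assms(2) by simp
  ultimately have "window_part m N \<zeta> = M" using fin by (metis card_subset_eq)
  then show ?thesis using basis triv by (auto simp: fock_window_def)
qed

lemma bij_betw_fock_window:
  "bij_betw (window_part m N) (fock_window m N)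
    {M. M \<subseteq> {- int N - 1<..int N} \<and> int (card M) = m + int N + 1}"
  unfolding bij_betw_def
proof (intro conjI equalityI subsetI inj_onI)
  fix \<zeta> \<zeta>' assume a: "\<zeta> \<in> fock_window m N" "\<zeta>' \<in> fock_window m N" "window_part m N \<zeta> = window_part m N \<zeta>'"
  have "c \<in> \<zeta> ` {..m} \<longleftrightarrow> c \<in> \<zeta>' ` {..m}" for c
  proof (cases "c \<in> {- int N - 1<..int N}")
    case True
    then show ?thesis using a(3) by (auto simp: window_part_def)
  next
    case False
    then have "c > int N \<or> c < - int N" by auto
    then show ?thesis using a(1,2)
      unfolding fock_window_def trivial_outside_def column_spin_iff by blast
  qed
  then have "\<zeta> ` {..m} = \<zeta>' ` {..m}" by blast
  then show "\<zeta> = \<zeta>'" using a fock_eqI by (auto simp: fock_window_def)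
next
  fix M assume "M \<in> window_part m N ` fock_window m N"
  then show "M \<in> {M. M \<subseteq> {- int N - 1<..int N} \<and> int (card M) = m + int N + 1}"
    using card_window_part by (auto simp: fock_window_def) (auto simp: window_part_def)
next
  fix M assume "M \<in> {M. M \<subseteq> {- int N - 1<..int N} \<and> int (card M) = m + int N + 1}"
  then show "M \<in> window_part m N ` fock_window m N"
    using fock_window_exists[of M N m] by auto
qed

section \<open>Finite exhaustions of the Fock basis\<close>

lemma finite_fock_window: "finite (fock_window m N)"
proof -
  have "finite {M. M \<subseteq> {- int N - 1<..int N} \<and> int (card M) = m + int N + 1}"
    by (rule finite_subset[of _ "Pow {- int N - 1<..int N}"]) auto
  then show ?thesis using bij_betw_finite[OF bij_betw_fock_window] by blast
qed

text \<open>Windows, and below also the vectors of bounded degree, eventually contain every finite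
  set of basis vectors. A limit over all finite subsets can thus be read off along either
  sequence.\<close>

lemma fock_window_exhaust:
  "filterlim (fock_window m) (finite_subsets_at_top (fock_basis m)) sequentially"
  unfolding filterlim_finite_subsets_at_top
proof (intro allI impI)
  fix X assume X: "finite X \<and> X \<subseteq> fock_basis m"
  have "\<forall>\<zeta>\<in>X. \<exists>N. trivial_outside m N \<zeta>" using X fock_trivial_outside by (metis subsetD)
  then obtain f where f: "\<And>\<zeta>. \<zeta> \<in> X \<Longrightarrow> trivial_outside m (f \<zeta>) \<zeta>" by metis
  have "X \<subseteq> fock_window m N" if "N \<ge> (\<Sum>\<zeta>\<in>X. f \<zeta>)" for N
  proof
    fix \<zeta> assume z: "\<zeta> \<in> X"
    then have "f \<zeta> \<le> (\<Sum>\<zeta>\<in>X. f \<zeta>)" using X by (intro member_le_sum) auto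
    then have "trivial_outside m N \<zeta>" using trivial_outside_mono[OF f[OF z]] that by simp
    then show "\<zeta> \<in> fock_window m N" using z X by (auto simp: fock_window_def)
  qed
  then show "\<forall>\<^sub>F N in sequentially. finite (fock_window m N) \<and> X \<subseteq> fock_window m N \<and> fock_window m N \<subseteq> fock_basis m"
    using finite_fock_window unfolding eventually_sequentially
    by (intro exI[of _ "\<Sum>\<zeta>\<in>X. f \<zeta>"]) (auto simp: fock_window_def)
qed

lemma finite_defects:
  assumes "\<zeta> \<in> fock_basis m"
  shows "finite {k. k \<le> m \<and> \<zeta> k \<noteq> k}"
proof -
  obtain K where "\<And>k. k \<le> K \<Longrightarrow> \<zeta> k = k" using fock_eventually[OF assms] by blast
  then have "{k. k \<le> m \<and> \<zeta> k \<noteq> k} \<subseteq> {K..m}" by (auto simp: not_le[symmetric]) (metis linear)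
  then show ?thesis by (rule finite_subset) simp
qed

lemma fock_degree_nonneg: "\<zeta> \<in> fock_basis m \<Longrightarrow> fock_degree m \<zeta> \<ge> 0"
  unfolding fock_degree_def by (rule sum_nonneg) (use fock_ge in auto)

text \<open>The differences \<open>\<zeta> k - k\<close> are monotone in \<open>k\<close>, so one
  displaced particle displaces all those above it. The degree therefore bounds the number of
  displaced particles as well as each displacement.\<close>

lemma fock_degree_window:
  assumes "\<zeta> \<in> fock_basis m"
  shows "\<zeta> \<in> fock_window m (nat (\<bar>m\<bar> + fock_degree m \<zeta>))"
proof -
  define d where "d = fock_degree m \<zeta>"
  have d: "d \<ge> 0" using fock_degree_nonneg[OF assms] by (simp add: d_def)
  have single: "\<zeta> k - k \<le> d" if "k \<le> m" for k
  proof (cases "\<zeta> k = k")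
    case False
    then show ?thesis unfolding d_def fock_degree_def
      using finite_defects[OF assms] that fock_ge[OF assms] by (intro member_le_sum) auto
  qed (use d in auto)
  have id: "\<zeta> k = k" if "k \<le> m - d" for k
  proof (rule ccontr)
    assume ne: "\<zeta> k \<noteq> k"
    have "1 \<le> \<zeta> j - j" if "j \<in> {k..m}" for j
      using fock_defect_mono[OF assms, of k j] fock_ge[OF assms, of k] ne that by force
    then have "(\<Sum>j\<in>{k..m}. 1) \<le> (\<Sum>j\<in>{k..m}. \<zeta> j - j)" by (intro sum_mono) auto
    also have "\<dots> \<le> d" unfolding d_def fock_degree_def
    proof (rule sum_mono2)
      show "{k..m} \<subseteq> {k. k \<le> m \<and> \<zeta> k \<noteq> k}"
        using \<open>\<And>j. j \<in> {k..m} \<Longrightarrow> 1 \<le> \<zeta> j - j\<close> by force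
    qed (use finite_defects[OF assms] fock_ge[OF assms] in auto)
    finally show False using that d by simp
  qed
  have "trivial_outside m (nat (\<bar>m\<bar> + d)) \<zeta>"
    by (rule trivial_outsideI[OF assms id]) (use single[of m] d in auto)
  then show ?thesis using assms by (simp add: fock_window_def d_def)
qed

definition fock_ball :: "int \<Rightarrow> nat \<Rightarrow> (int \<Rightarrow> int) set" where
  "fock_ball m K = {\<zeta> \<in> fock_basis m. fock_degree m \<zeta> < int K}"

lemma finite_fock_ball: "finite (fock_ball m K)"
proof (rule finite_subset)
  show "fock_ball m K \<subseteq> fock_window m (nat (\<bar>m\<bar> + int K))"
  proof
    fix \<zeta> assume "\<zeta> \<in> fock_ball m K"
    then have z: "\<zeta> \<in> fock_basis m" "fock_degree m \<zeta> < int K" by (auto simp: fock_ball_def)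
    then show "\<zeta> \<in> fock_window m (nat (\<bar>m\<bar> + int K))"
      using fock_degree_window[OF z(1)] trivial_outside_mono[of m "nat (\<bar>m\<bar> + fock_degree m \<zeta>)" \<zeta> "nat (\<bar>m\<bar> + int K)"]
      by (auto simp: fock_window_def)
  qed
qed (rule finite_fock_window)

lemma fock_ball_exhaust:
  "filterlim (fock_ball m) (finite_subsets_at_top (fock_basis m)) sequentially"
  unfolding filterlim_finite_subsets_at_top
proof (intro allI impI)
  fix X assume X: "finite X \<and> X \<subseteq> fock_basis m"
  define B where "B = (\<Sum>\<zeta>\<in>X. nat (fock_degree m \<zeta>)) + 1"
  have "X \<subseteq> fock_ball m K" if "K \<ge> B" for K
  proof
    fix \<zeta> assume z: "\<zeta> \<in> X"
    then have "nat (fock_degree m \<zeta>) \<le> (\<Sum>\<zeta>\<in>X. nat (fock_degree m \<zeta>))"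
      using X member_le_sum[of \<zeta> X "\<lambda>\<zeta>. nat (fock_degree m \<zeta>)"] by simp
    then have "fock_degree m \<zeta> < int K" using that by (simp add: B_def)
    then show "\<zeta> \<in> fock_ball m K" using z X by (auto simp: fock_ball_def)
  qed
  then show "\<forall>\<^sub>F K in sequentially. finite (fock_ball m K) \<and> X \<subseteq> fock_ball m K \<and> fock_ball m K \<subseteq> fock_basis m"
    using finite_fock_ball unfolding eventually_sequentially
    by (intro exI[of _ B]) (auto simp: fock_ball_def)
qed

lemma sum_prod_degree_term:
  "(\<Sum>d<K. prod_degree_term m A B \<eta> \<xi> d) = (\<Sum>\<zeta>\<in>fock_ball m K. A \<eta> \<zeta> * B \<zeta> \<xi>)"
proof -
  have "(\<Sum>d<K. prod_degree_term m A B \<eta> \<xi> d) =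
    (\<Sum>d<K. \<Sum>\<zeta> | \<zeta> \<in> fock_ball m K \<and> nat (fock_degree m \<zeta>) = d. A \<eta> \<zeta> * B \<zeta> \<xi>)"
    unfolding prod_degree_term_def
    by (intro sum.cong refl) (auto simp: fock_ball_def fock_degree_nonneg)
  also have "\<dots> = (\<Sum>\<zeta>\<in>fock_ball m K. A \<eta> \<zeta> * B \<zeta> \<xi>)"
    by (intro sum.group finite_fock_ball) (auto simp: fock_ball_def nat_less_iff fock_degree_nonneg)
  finally show ?thesis .
qed

text \<open>Bounded sums of norms give unconditional summability. The sum then has one value, which
  is computed along windows and required along degrees.\<close>

lemma prod_degree_term_sums:
  assumes bound: "\<And>N. N \<ge> N0 \<Longrightarrow> (\<Sum>\<zeta>\<in>fock_window m N. norm (A \<eta> \<zeta> * B \<zeta> \<xi>)) \<le> C"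
    and lim: "(\<lambda>N. \<Sum>\<zeta>\<in>fock_window m N. A \<eta> \<zeta> * B \<zeta> \<xi>) \<longlonglongrightarrow> S"
  shows "prod_degree_term m A B \<eta> \<xi> sums S"
proof -
  define f where "f = (\<lambda>\<zeta>. A \<eta> \<zeta> * B \<zeta> \<xi>)"
  have "f abs_summable_on fock_basis m"
    unfolding abs_summable_iff_bdd_above
  proof (rule bdd_aboveI2)
    fix F assume F: "F \<in> {F. F \<subseteq> fock_basis m \<and> finite F}"
    then have "\<forall>\<^sub>F N in sequentially. F \<subseteq> fock_window m N"
      using fock_window_exhaust[of m] unfolding filterlim_finite_subsets_at_top
      by (metis (mono_tags, lifting) eventually_mono mem_Collect_eq)
    then have "\<forall>\<^sub>F N in sequentially. F \<subseteq> fock_window m N \<and> N \<ge> N0"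
      using eventually_ge_at_top by (rule eventually_conj)
    then obtain N where "F \<subseteq> fock_window m N" and N: "N \<ge> N0"
      by (metis (mono_tags, lifting) eventually_happens trivial_limit_sequentially)
    then have "(\<Sum>\<zeta>\<in>F. norm (f \<zeta>)) \<le> (\<Sum>\<zeta>\<in>fock_window m N. norm (f \<zeta>))"
      by (intro sum_mono2 finite_fock_window) auto
    then show "(\<Sum>\<zeta>\<in>F. norm (f \<zeta>)) \<le> C" using bound[OF N] by (simp add: f_def)
  qed
  then have "f summable_on fock_basis m" by (rule abs_summable_summable)
  then obtain T where T: "(f has_sum T) (fock_basis m)" by (auto simp: summable_on_def)
  then have T: "(sum f \<longlongrightarrow> T) (finite_subsets_at_top (fock_basis m))" by (simp add: has_sum_def)
  have "(\<lambda>N. sum f (fock_window m N)) \<longlonglongrightarrow> T"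
    by (rule filterlim_compose[OF T fock_window_exhaust])
  with lim have "T = S" unfolding f_def by (metis LIMSEQ_unique)
  moreover have "(\<lambda>K. sum f (fock_ball m K)) \<longlonglongrightarrow> T"
    by (rule filterlim_compose[OF T fock_ball_exhaust])
  ultimately show ?thesis unfolding sums_def sum_prod_degree_term f_def by simp
qed

section \<open>Products of two rows\<close>

lemma sum_charge_spin_of: "M \<subseteq> I \<Longrightarrow> finite I \<Longrightarrow> (\<Sum>i\<in>I. charge (spin_of M i)) = int (card M)"
proof -
  assume M: "M \<subseteq> I" "finite I"
  have "(\<Sum>i\<in>I. charge (spin_of M i)) = (\<Sum>i\<in>I. if i \<in> M then 1 else 0)"
    by (intro sum.cong) (auto simp: charge_def spin_of_def)
  also have "\<dots> = int (card M)" using M by (simp add: sum.If_cases Int_absorb1)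
  finally show ?thesis .
qed

lemma column_spin_window:
  "i \<in> {- int N - 1<..int N} \<Longrightarrow> column_spin m \<zeta> i = spin_of (window_part m N \<zeta>) i"
  by (simp add: column_spin_def spin_of_def window_part_def)

lemma window_interval: "{- int N - 1<..- int N - 1 + int (2 * N + 1)} = {- int N - 1<..int N}"
  by simp

text \<open>The subsets of the window with the right number of elements correspond to the vectors
  \<open>\<zeta>\<close>; the other subsets contribute 0 because the top row conserves
  charge.\<close>

lemma window_product:
  assumes model: "row_model n W1 e1" "row_model n W2 e2"
    and \<eta>: "trivial_outside m N \<eta>" and \<xi>: "\<xi> \<in> fock_window m N"
  shows "(\<Sum>\<zeta>\<in>fock_window m N. row_coeff n W2 e2 m \<eta> \<zeta> * row_coeff n W1 e1 m \<zeta> \<xi>) =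
    window (\<lambda>i. pair_step n W1 W2 (column_spin m \<xi> i) (column_spin m \<eta> i)) N
      (\<lambda>p1 p2. (if p1 = e1 then 1 else 0) * (if p2 = e2 then 1 else 0)) e1 e2"
proof -
  define I where "I = {- int N - 1<..int N}"
  define h where "h = (\<lambda>M. row_value n W1 e1 (column_spin m \<xi>) (spin_of M) (- int N - 1) (2 * N + 1) e1 *
    row_value n W2 e2 (spin_of M) (column_spin m \<eta>) (- int N - 1) (2 * N + 1) e2)"
  have \<xi>': "\<xi> \<in> fock_basis m" "trivial_outside m N \<xi>" using \<xi> by (auto simp: fock_window_def)
  have summand: "row_coeff n W2 e2 m \<eta> \<zeta> * row_coeff n W1 e1 m \<zeta> \<xi> = h (window_part m N \<zeta>)"
    if "\<zeta> \<in> fock_window m N" for \<zeta>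
  proof -
    have \<zeta>: "trivial_outside m N \<zeta>" using that by (simp add: fock_window_def)
    have eq: "row_value n W1 e1 (column_spin m \<xi>) (column_spin m \<zeta>) (- int N - 1) (2 * N + 1) =
        row_value n W1 e1 (column_spin m \<xi>) (spin_of (window_part m N \<zeta>)) (- int N - 1) (2 * N + 1)"
      "row_value n W2 e2 (column_spin m \<zeta>) (column_spin m \<eta>) (- int N - 1) (2 * N + 1) =
        row_value n W2 e2 (spin_of (window_part m N \<zeta>)) (column_spin m \<eta>) (- int N - 1) (2 * N + 1)"
      by (rule row_value_cong; simp add: column_spin_window[of _ N])+
    show ?thesis
      unfolding h_def row_model.row_coeff_window[OF model(1) \<zeta> \<xi>'(2)]
        row_model.row_coeff_window[OF model(2) \<eta> \<zeta>] eq by (rule mult.commute)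
  qed
  have zero: "h M = 0" if M: "M \<subseteq> I" "int (card M) \<noteq> m + int N + 1" for M
  proof (rule ccontr)
    assume "h M \<noteq> 0"
    then have "row_value n W1 e1 (column_spin m \<xi>) (spin_of M) (- int N - 1) (2 * N + 1) e1 \<noteq> 0"
      by (auto simp: h_def)
    from row_model.row_value_charge[OF model(1) this]
    have "(\<Sum>i\<in>I. charge (column_spin m \<xi> i)) = (\<Sum>i\<in>I. charge (spin_of M i))"
      unfolding window_interval I_def by simp
    also have "(\<Sum>i\<in>I. charge (column_spin m \<xi> i)) = (\<Sum>i\<in>I. charge (spin_of (window_part m N \<xi>) i))"
      by (intro sum.cong) (simp_all add: column_spin_window[of _ N] I_def)
    also have "\<dots> = m + int N + 1"
    proof -
      have "window_part m N \<xi> \<subseteq> I" "finite I" by (auto simp: window_part_def I_def)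
      then show ?thesis using card_window_part[OF \<xi>'] by (simp add: sum_charge_spin_of)
    qed
    also have "(\<Sum>i\<in>I. charge (spin_of M i)) = int (card M)"
      using M by (intro sum_charge_spin_of) (auto simp: I_def)
    finally show False using M by simp
  qed
  have "(\<Sum>\<zeta>\<in>fock_window m N. row_coeff n W2 e2 m \<eta> \<zeta> * row_coeff n W1 e1 m \<zeta> \<xi>) =
    (\<Sum>\<zeta>\<in>fock_window m N. h (window_part m N \<zeta>))"
    by (intro sum.cong refl summand)
  also have "\<dots> = (\<Sum>M | M \<subseteq> I \<and> int (card M) = m + int N + 1. h M)"
    unfolding I_def by (rule sum.reindex_bij_betw[OF bij_betw_fock_window])
  also have "\<dots> = (\<Sum>M\<in>Pow I. h M)"
  proof (rule sum.mono_neutral_left)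
    show "finite (Pow I)" by (simp add: I_def)
    show "\<forall>M\<in>Pow I - {M. M \<subseteq> I \<and> int (card M) = m + int N + 1}. h M = 0" using zero by blast
  qed blast
  finally show ?thesis
    unfolding window_def pair_value window_interval h_def I_def .
qed

text \<open>The majorant is a real number inside the complex numbers, so that the ice model and its
  limit theorems apply to it unchanged.\<close>

definition dominates :: "complex \<Rightarrow> complex \<Rightarrow> bool" where
  "dominates b a \<longleftrightarrow> (\<exists>r. b = of_real r \<and> norm a \<le> r)"

lemma dominates_mult:
  assumes "dominates b a" "dominates d c"
  shows "dominates (b * d) (a * c)"
proof -
  from assms obtain r s where "b = of_real r" "norm a \<le> r" "d = of_real s" "norm c \<le> s"
    unfolding dominates_def by blast
  then have "b * d = of_real (r * s)" "norm (a * c) \<le> r * s"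
    unfolding norm_mult by (simp, intro mult_mono) (auto intro: order_trans[OF norm_ge_zero])
  then show ?thesis unfolding dominates_def by blast
qed

lemma dominates_sum:
  assumes "\<And>i. i \<in> I \<Longrightarrow> dominates (f i) (h i)"
  shows "dominates (sum f I) (sum h I)"
proof -
  have "\<forall>i\<in>I. \<exists>r. f i = of_real r \<and> norm (h i) \<le> r"
    using assms unfolding dominates_def by blast
  then obtain r where r: "\<forall>i\<in>I. f i = of_real (r i) \<and> norm (h i) \<le> r i"
    unfolding bchoice_iff by blast
  have "sum f I = of_real (sum r I)" unfolding of_real_sum using r by (intro sum.cong) blast+
  moreover have "norm (sum h I) \<le> sum r I" using r by (intro sum_norm_le) blast
  ultimately show ?thesis unfolding dominates_def by blast
qed

lemma dominates_row_value:
  assumes "\<And>l t r b. dominates (weight_val W' l t r b) (weight_val W l t r b)"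
  shows "dominates (row_value n W' e t b c k p) (row_value n W e t b c k p)"
proof (induction k arbitrary: p)
  case 0
  have "row_value n W' e t b c 0 p = of_real (norm (row_value n W e t b c 0 p))" by simp
  then show ?case unfolding dominates_def by blast
next
  case (Suc k)
  then show ?case unfolding row_value_Suc row_step_def
    by (intro dominates_sum dominates_mult assms)
qed

text \<open>The weights depend on \<open>v\<close> only through \<open>1 - v\<close>, so their absolute values are again weights of
  the model, with \<open>1 - \<bar>1 - v\<bar>\<close> in place of \<open>v\<close>.\<close>

lemma dominates_delta:
  "dominates (weight_val (delta_weight n (1 - of_real (norm (1 - v))) (\<lambda>a. of_real (norm (g a))) (of_real (norm z))) l t r b)
    (weight_val (delta_weight n v g z) l t r b)"
proof -
  let ?v = "1 - complex_of_real (norm (1 - v))" and ?g = "\<lambda>a. complex_of_real (norm (g a))"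
  obtain l1 l2 r1 r2 where "l = (l1, l2)" "r = (r1, r2)" by (cases l, cases r)
  then have "weight_val (delta_weight n ?v ?g (of_real (norm z))) l t r b =
      of_real (norm (weight_val (delta_weight n v g z) l t r b))"
    by (cases l1; cases t; cases r1; cases b) (simp_all add: weight_val_def norm_mult)
  then show ?thesis unfolding dominates_def by blast
qed

lemma dominates_gamma:
  "dominates (weight_val (gamma_weight n (1 - of_real (norm (1 - v))) (\<lambda>a. of_real (norm (g a))) (of_real (norm z))) l t r b)
    (weight_val (gamma_weight n v g z) l t r b)"
proof -
  let ?v = "1 - complex_of_real (norm (1 - v))" and ?g = "\<lambda>a. complex_of_real (norm (g a))"
  obtain l1 l2 r1 r2 where "l = (l1, l2)" "r = (r1, r2)" by (cases l, cases r)
  then have "weight_val (gamma_weight n ?v ?g (of_real (norm z))) l t r b =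
      of_real (norm (weight_val (gamma_weight n v g z) l t r b))"
    by (cases l1; cases t; cases r1; cases b) (simp_all add: weight_val_def norm_mult norm_inverse)
  then show ?thesis unfolding dominates_def by blast
qed

context ice_pair begin

section \<open>Convergence of the two operator products\<close>

lemma evolve_DG_swap:
  "evolve (\<lambda>c. step_DG (t c) (b c)) c k vac p q =
   evolve (\<lambda>c. pair_step n gamma delta (t c) (b c)) c k
     (\<lambda>p1 p2. (if p1 = gvac then 1 else 0) * (if p2 = dvac then 1 else 0)) q p"
proof (induction k arbitrary: p q)
  case (Suc k)
  then show ?case by (simp add: step_DG_def)
qed (simp add: vac_def)

lemma evolve_GD_eq:
  "evolve (\<lambda>c. step_GD (t c) (b c)) c k vac =
   evolve (\<lambda>c. pair_step n delta gamma (t c) (b c)) c k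
     (\<lambda>p1 p2. (if p1 = dvac then 1 else 0) * (if p2 = gvac then 1 else 0))"
proof -
  have "vac = (\<lambda>p1 p2. (if p1 = dvac then 1 else 0) * (if p2 = gvac then 1 else 0))"
    by (auto simp: vac_def fun_eq_iff)
  moreover have "step_GD t b = pair_step n delta gamma t b" for t b
    by (intro ext) (rule step_GD_def)
  ultimately show ?thesis by simp
qed

lemma window_sum_DG:
  assumes "trivial_outside m N \<eta>" "\<xi> \<in> fock_window m N"
  shows "(\<Sum>\<zeta>\<in>fock_window m N. T_Delta n v g m z \<eta> \<zeta> * T_Gamma n v g m w \<zeta> \<xi>) =
    window (\<lambda>c. step_DG (column_spin m \<xi> c) (column_spin m \<eta> c)) N vac dvac gvac"
  unfolding T_Delta_def T_Gamma_def
    window_product[OF row_model_gamma[OF n_pos] row_model_delta[OF n_pos] assms]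
  unfolding window_def evolve_DG_swap ..

lemma window_sum_GD:
  assumes "trivial_outside m N \<eta>" "\<xi> \<in> fock_window m N"
  shows "(\<Sum>\<zeta>\<in>fock_window m N. T_Gamma n v g m w \<eta> \<zeta> * T_Delta n v g m z \<zeta> \<xi>) =
    window (\<lambda>c. step_GD (column_spin m \<xi> c) (column_spin m \<eta> c)) N vac dvac gvac"
  unfolding T_Delta_def T_Gamma_def
    window_product[OF row_model_delta[OF n_pos] row_model_gamma[OF n_pos] assms]
  unfolding window_def evolve_GD_eq ..

text \<open>Delta ice, acting first, puts no particle to the left of those of \<open>\<xi>\<close>.
  Gamma ice then cannot fill a hole of \<open>\<zeta>\<close> among the columns far to the right,
  where \<open>\<eta>\<close> has none.\<close>

lemma GD_support:
  assumes "trivial_outside m N \<eta>" "trivial_outside m N \<xi>" "\<zeta> \<in> fock_basis m"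
    and "T_Gamma n v g m w \<eta> \<zeta> * T_Delta n v g m z \<zeta> \<xi> \<noteq> 0"
  shows "\<zeta> \<in> fock_window m N"
proof -
  have nz: "row_coeff n gamma gvac m \<eta> \<zeta> \<noteq> 0" "row_coeff n delta dvac m \<zeta> \<xi> \<noteq> 0"
    using assms(4) by (auto simp: T_Delta_def T_Gamma_def)
  have "delta dvac SPlus r SMinus = None" for r
    by (cases r; cases "fst r") auto
  then have "column_spin m \<zeta> c = SPlus" if "c > int N" for c
    using row_model.row_coeff_support_left[OF row_model_delta[OF n_pos] nz(2) _ _ that] assms(2)
    by (auto simp: trivial_outside_def)
  moreover have "gamma l SPlus gvac SMinus = None" for l
    by (cases l; cases "fst l") auto
  then have "column_spin m \<zeta> c = SMinus" if "c < - int N" for c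
    using row_model.row_coeff_support_right[OF row_model_gamma[OF n_pos] nz(1) _ _ that] assms(1)
    by (auto simp: trivial_outside_def)
  ultimately show ?thesis using assms(3) by (simp add: fock_window_def trivial_outside_def)
qed

lemma GD_sums:
  assumes "trivial_outside m N \<eta>" "\<xi> \<in> fock_window m N"
  shows "prod_degree_term m (T_Gamma n v g m w) (T_Delta n v g m z) \<eta> \<xi> sums
    window (\<lambda>c. step_GD (column_spin m \<xi> c) (column_spin m \<eta> c)) N vac dvac gvac"
proof -
  define f where "f = (\<lambda>\<zeta>. T_Gamma n v g m w \<eta> \<zeta> * T_Delta n v g m z \<zeta> \<xi>)"
  have \<xi>: "trivial_outside m N \<xi>" using assms(2) by (simp add: fock_window_def)
  have f0: "f \<zeta> = 0" if "\<zeta> \<in> fock_basis m" "\<zeta> \<notin> fock_window m N" for \<zeta>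
    using GD_support[OF assms(1) \<xi> that(1)] that(2) unfolding f_def by blast
  have sub: "fock_window m N \<subseteq> fock_window m M" if "M \<ge> N" for M
    using trivial_outside_mono that by (auto simp: fock_window_def)
  have eq: "(\<Sum>\<zeta>\<in>fock_window m M. h (f \<zeta>)) = (\<Sum>\<zeta>\<in>fock_window m N. h (f \<zeta>))"
    if "M \<ge> N" "h 0 = 0" for M and h :: "complex \<Rightarrow> 'c :: comm_monoid_add"
  proof (rule sum.mono_neutral_right)
    show "\<forall>\<zeta>\<in>fock_window m M - fock_window m N. h (f \<zeta>) = 0"
      using f0 that(2) by (simp add: fock_window_def)
  qed (rule finite_fock_window, rule sub[OF that(1)])
  show ?thesis
  proof (rule prod_degree_term_sums[where ?N0.0 = N and C = "\<Sum>\<zeta>\<in>fock_window m N. norm (f \<zeta>)"])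
    show "(\<Sum>\<zeta>\<in>fock_window m M. norm (T_Gamma n v g m w \<eta> \<zeta> * T_Delta n v g m z \<zeta> \<xi>))
      \<le> (\<Sum>\<zeta>\<in>fock_window m N. norm (f \<zeta>))" if "M \<ge> N" for M
      using eq[OF that, of norm] by (simp add: f_def)
    have "\<forall>\<^sub>F M in sequentially. (\<Sum>\<zeta>\<in>fock_window m M. f \<zeta>) = (\<Sum>\<zeta>\<in>fock_window m N. f \<zeta>)"
      using eventually_ge_at_top[of N] by eventually_elim (rule eq[of _ "\<lambda>y. y"], simp_all)
    then show "(\<lambda>M. \<Sum>\<zeta>\<in>fock_window m M. T_Gamma n v g m w \<eta> \<zeta> * T_Delta n v g m z \<zeta> \<xi>) \<longlonglongrightarrow>
      window (\<lambda>c. step_GD (column_spin m \<xi> c) (column_spin m \<eta> c)) N vac dvac gvac"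
      unfolding window_sum_GD[OF assms, symmetric] f_def by (rule tendsto_eventually)
  qed
qed

text \<open>Absolute values respect the square of \<open>g 0\<close> but not its sign. The locale
  predicate leaves \<open>v\<close> free, so it can be instantiated with
  \<open>1 - norm (1 - v)\<close>.\<close>

lemma ice_pair_norm:
  "ice_pair n (of_real (norm u)) (of_real (norm z)) (of_real (norm w)) (\<lambda>a. of_real (norm (g a)))"
proof
  show "complex_of_real (norm (g 0)) ^ 2 = of_real (norm u) ^ 2"
    using arg_cong[OF g_zero, of norm] by (simp add: norm_power flip: of_real_power)
  show "complex_of_real (norm (g a)) * of_real (norm (g (- a))) = of_real (norm u)"
    if "\<not> int n dvd a" for a
    using arg_cong[OF g_inv[OF that], of norm] by (simp add: norm_mult flip: of_real_mult)
  show "complex_of_real (norm (g (a + int n))) = of_real (norm (g a))" for a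
    by (simp only: g_periodic)
qed (use n_pos z_nonzero w_nonzero in auto)

text \<open>The conditions of \<open>window_limit\<close> involve only the moduli of
  \<open>x\<close> and \<open>u\<close>, hence hold for the majorising weights too. Their window
  sums converge and so are bounded.\<close>

lemma DG_bounded:
  assumes "norm x < 1" "norm (u ^ (n + 1) * x ^ n) < 1"
    and \<eta>: "trivial_outside m N0 \<eta>" and \<xi>: "\<xi> \<in> fock_window m N0"
  obtains C where "\<And>N. N \<ge> N0 \<Longrightarrow>
    (\<Sum>\<zeta>\<in>fock_window m N. norm (T_Delta n v g m z \<eta> \<zeta> * T_Gamma n v g m w \<zeta> \<xi>)) \<le> C"
proof -
  define v' g' z' w' where "v' = 1 - complex_of_real (norm (1 - v))"
    and "g' = (\<lambda>a. complex_of_real (norm (g a)))"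
    and "z' = complex_of_real (norm z)" and "w' = complex_of_real (norm w)"
  interpret N: ice_pair n v' "of_real (norm u)" z' w' g'
    unfolding g'_def z'_def w'_def by (rule ice_pair_norm)
  define S where "S = (\<lambda>c. N.step_DG (column_spin m \<xi> c) (column_spin m \<eta> c))"
  have x: "N.x = of_real (norm x)" unfolding N.x_def by (simp add: x_def z'_def w'_def norm_divide)
  have "(\<lambda>N. window S N N.vac dvac gvac) \<longlonglongrightarrow>
      N.left_functional (window S N0 N.right_vector) / (N.x * (1 - N.x ^ n))"
    unfolding S_def
  proof (rule N.window_limit)
    show "norm N.x < 1" using assms(1) by (simp add: x)
    show "norm (complex_of_real (norm u) ^ (n + 1) * N.x ^ n) < 1"
      using assms(2) by (simp add: x norm_mult norm_power)
  qed (use \<eta> \<xi> in \<open>simp_all add: trivial_outside_def fock_window_def\<close>)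
  then have "Bseq (\<lambda>N. window S N N.vac dvac gvac)"
    by (intro convergent_imp_Bseq convergentI)
  then obtain C where C: "\<And>N. norm (window S N N.vac dvac gvac) \<le> C"
    by (elim BseqE) blast
  have "(\<Sum>\<zeta>\<in>fock_window m N. norm (T_Delta n v g m z \<eta> \<zeta> * T_Gamma n v g m w \<zeta> \<xi>)) \<le> C"
    if N: "N \<ge> N0" for N
  proof -
    have \<eta>N: "trivial_outside m N \<eta>" and \<xi>N: "\<xi> \<in> fock_window m N"
      using \<eta> \<xi> trivial_outside_mono[OF _ N] by (auto simp: fock_window_def)
    have le: "norm (T_Delta n v g m z \<eta> \<zeta> * T_Gamma n v g m w \<zeta> \<xi>) \<le>
        Re (T_Delta n v' g' m z' \<eta> \<zeta> * T_Gamma n v' g' m w' \<zeta> \<xi>)" if "\<zeta> \<in> fock_window m N" for \<zeta>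
    proof -
      have t: "trivial_outside m N \<zeta>" "trivial_outside m N \<xi>"
        using that \<xi>N by (auto simp: fock_window_def)
      have "dominates (T_Delta n v' g' m z' \<eta> \<zeta>) (T_Delta n v g m z \<eta> \<zeta>)"
        unfolding T_Delta_def row_model.row_coeff_window[OF row_model_delta[OF n_pos] \<eta>N t(1)]
        unfolding v'_def g'_def z'_def by (rule dominates_row_value[OF dominates_delta])
      moreover have "dominates (T_Gamma n v' g' m w' \<zeta> \<xi>) (T_Gamma n v g m w \<zeta> \<xi>)"
        unfolding T_Gamma_def row_model.row_coeff_window[OF row_model_gamma[OF n_pos] t]
        unfolding v'_def g'_def w'_def by (rule dominates_row_value[OF dominates_gamma])
      ultimately have "dominates (T_Delta n v' g' m z' \<eta> \<zeta> * T_Gamma n v' g' m w' \<zeta> \<xi>)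
        (T_Delta n v g m z \<eta> \<zeta> * T_Gamma n v g m w \<zeta> \<xi>)" by (rule dominates_mult)
      then obtain r where r: "T_Delta n v' g' m z' \<eta> \<zeta> * T_Gamma n v' g' m w' \<zeta> \<xi> = of_real r"
        "norm (T_Delta n v g m z \<eta> \<zeta> * T_Gamma n v g m w \<zeta> \<xi>) \<le> r"
        unfolding dominates_def by blast
      show ?thesis unfolding r(1) Re_complex_of_real by (rule r(2))
    qed
    have "(\<Sum>\<zeta>\<in>fock_window m N. norm (T_Delta n v g m z \<eta> \<zeta> * T_Gamma n v g m w \<zeta> \<xi>)) \<le>
      (\<Sum>\<zeta>\<in>fock_window m N. Re (T_Delta n v' g' m z' \<eta> \<zeta> * T_Gamma n v' g' m w' \<zeta> \<xi>))"
      by (rule sum_mono) (rule le)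
    also have "\<dots> = Re (\<Sum>\<zeta>\<in>fock_window m N. T_Delta n v' g' m z' \<eta> \<zeta> * T_Gamma n v' g' m w' \<zeta> \<xi>)"
      by (rule Re_sum[symmetric])
    also have "\<dots> = Re (window S N N.vac dvac gvac)"
      unfolding N.window_sum_DG[OF \<eta>N \<xi>N] S_def ..
    also have "\<dots> \<le> C" using C[of N] complex_Re_le_cmod order_trans by blast
    finally show ?thesis .
  qed
  then show ?thesis by (rule that)
qed

lemma DG_sums:
  assumes "v = u" "g 0 = - v" "norm x < 1" "norm (v ^ (n + 1) * x ^ n) < 1"
    and \<eta>: "trivial_outside m N \<eta>" and \<xi>: "\<xi> \<in> fock_window m N"
  shows "prod_degree_term m (T_Delta n v g m z) (T_Gamma n v g m w) \<eta> \<xi> sums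
    ((1 - v * x ^ n) * (1 - v ^ n * x ^ n) / ((1 - x ^ n) * (1 - v ^ (n + 1) * x ^ n)) *
     window (\<lambda>c. step_GD (column_spin m \<xi> c) (column_spin m \<eta> c)) N vac dvac gvac)"
proof -
  obtain C where C: "\<And>N'. N' \<ge> N \<Longrightarrow>
      (\<Sum>\<zeta>\<in>fock_window m N'. norm (T_Delta n v g m z \<eta> \<zeta> * T_Gamma n v g m w \<zeta> \<xi>)) \<le> C"
  proof (rule DG_bounded[OF assms(3) _ \<eta> \<xi>])
    show "norm (u ^ (n + 1) * x ^ n) < 1" using assms(4) unfolding assms(1) .
  qed blast
  have "(\<lambda>N. window (\<lambda>c. step_DG (column_spin m \<xi> c) (column_spin m \<eta> c)) N vac dvac gvac) \<longlonglongrightarrow>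
    (1 - v * x ^ n) * (1 - v ^ n * x ^ n) / ((1 - x ^ n) * (1 - v ^ (n + 1) * x ^ n)) *
     window (\<lambda>c. step_GD (column_spin m \<xi> c) (column_spin m \<eta> c)) N vac dvac gvac"
    by (rule product_limit[OF assms(1-4)])
      (use \<eta> \<xi> in \<open>simp_all add: trivial_outside_def fock_window_def\<close>)
  moreover have "\<forall>\<^sub>F M in sequentially.
      window (\<lambda>c. step_DG (column_spin m \<xi> c) (column_spin m \<eta> c)) M vac dvac gvac =
      (\<Sum>\<zeta>\<in>fock_window m M. T_Delta n v g m z \<eta> \<zeta> * T_Gamma n v g m w \<zeta> \<xi>)"
    using eventually_ge_at_top[of N]
  proof eventually_elim
    case (elim M)
    then have "trivial_outside m M \<eta>" "\<xi> \<in> fock_window m M"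
      using \<eta> \<xi> trivial_outside_mono by (auto simp: fock_window_def)
    then show ?case by (rule window_sum_DG[symmetric])
  qed
  ultimately have lim: "(\<lambda>N. \<Sum>\<zeta>\<in>fock_window m N. T_Delta n v g m z \<eta> \<zeta> * T_Gamma n v g m w \<zeta> \<xi>) \<longlonglongrightarrow>
    (1 - v * x ^ n) * (1 - v ^ n * x ^ n) / ((1 - x ^ n) * (1 - v ^ (n + 1) * x ^ n)) *
     window (\<lambda>c. step_GD (column_spin m \<xi> c) (column_spin m \<eta> c)) N vac dvac gvac"
    by (rule Lim_transform_eventually)
  show ?thesis
    by (rule prod_degree_term_sums[where ?N0.0 = N and C = C]) (erule C, rule lim)
qed

end

theorem theorem7p3:
  fixes n :: nat and v z w :: complex and g :: "int \<Rightarrow> complex" and m :: int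
    and \<eta> \<xi> :: "int \<Rightarrow> int"
  assumes "n \<ge> 1"
    and "v \<noteq> 0" and "\<forall>k\<ge>1. v ^ k \<noteq> 1"
    and "\<forall>a. g (a + int n) = g a"
    and "g 0 = - v" and "\<forall>a. \<not> int n dvd a \<longrightarrow> g a * g (- a) = v"
    and "z \<noteq> 0" and "w \<noteq> 0"
    and "norm z < min 1 (norm v powr (- 1 - 1 / real n)) * norm w"
    and "\<eta> \<in> fock_basis m" and "\<xi> \<in> fock_basis m"
  shows "finite {\<zeta> \<in> fock_basis m. T_Gamma n v g m w \<eta> \<zeta> * T_Delta n v g m z \<zeta> \<xi> \<noteq> 0}
    \<and> summable (prod_degree_term m (T_Delta n v g m z) (T_Gamma n v g m w) \<eta> \<xi>)
    \<and> op_prod m (T_Delta n v g m z) (T_Gamma n v g m w) \<eta> \<xi> =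
        ((1 - v * z ^ n / w ^ n) * (1 - v ^ n * z ^ n / w ^ n)) /
        ((1 - z ^ n / w ^ n) * (1 - v ^ (n + 1) * z ^ n / w ^ n)) *
        op_prod m (T_Gamma n v g m w) (T_Delta n v g m z) \<eta> \<xi>"
proof -
  \<comment> \<open>For the actual weights the products of values of \<open>g\<close> equal
    \<open>v\<close>, so the parameter \<open>u\<close> becomes \<open>v\<close>.\<close>
  interpret ice_pair n v v z w g
  proof
    show "g (a + int n) = g a" for a using assms(4) by blast
    show "g a * g (- a) = v" if "\<not> int n dvd a" for a using assms(6) that by blast
    show "(g 0)\<^sup>2 = v\<^sup>2" unfolding assms(5) by simp
  qed (rule assms)+
  have xn: "norm x < min 1 (norm v powr (- 1 - 1 / real n))"
  proof -
    have "norm x * norm w = norm z" using assms(8) by (simp add: x_def norm_divide)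
    then show ?thesis using assms(8,9) by (metis mult_less_cancel_right_pos zero_less_norm_iff)
  qed
  then have x1: "norm x < 1" by simp
  \<comment> \<open>The \<open>n\<close>-th power turns the exponent \<open>- 1 - 1 / n\<close> into
    \<open>- (n + 1)\<close>, which is the convergence condition at the right end.\<close>
  have "norm x ^ n < (norm v powr (- 1 - 1 / real n)) ^ n"
    using xn by (intro power_strict_mono) auto
  also have "\<dots> = norm v powr ((- 1 - 1 / real n) * real n)"
    using assms(2) by (simp add: powr_powr flip: powr_realpow)
  also have "(- 1 - 1 / real n) * real n = - real (n + 1)"
    using assms(1) by (simp add: field_simps)
  also have "norm v powr (- real (n + 1)) = inverse (norm v ^ (n + 1))"
    using assms(2) by (simp only: powr_minus powr_realpow zero_less_norm_iff simp_thms)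
  finally have "norm v ^ (n + 1) * norm x ^ n < 1"
    using assms(2) by (simp add: field_simps)
  then have vx: "norm (v ^ (n + 1) * x ^ n) < 1"
    by (simp add: norm_mult norm_power)
  obtain N1 N2 where "trivial_outside m N1 \<eta>" "trivial_outside m N2 \<xi>"
    using fock_trivial_outside assms(10,11) by metis
  then have triv: "trivial_outside m (max N1 N2) \<eta>" "trivial_outside m (max N1 N2) \<xi>"
    using trivial_outside_mono by (metis max.cobounded1, metis max.cobounded2)
  then have \<xi>: "\<xi> \<in> fock_window m (max N1 N2)" using assms(11) by (simp add: fock_window_def)
  note GD = GD_sums[OF triv(1) \<xi>]
  note DG = DG_sums[OF refl assms(5) x1 vx triv(1) \<xi>]
  have "finite {\<zeta> \<in> fock_basis m. T_Gamma n v g m w \<eta> \<zeta> * T_Delta n v g m z \<zeta> \<xi> \<noteq> 0}"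
    by (rule finite_subset[OF _ finite_fock_window[of m "max N1 N2"]]) (use GD_support[OF triv] in blast)
  moreover have "x ^ n = z ^ n / w ^ n" by (simp add: x_def power_divide)
  ultimately show ?thesis
    using sums_summable[OF DG] sums_unique[OF DG] sums_unique[OF GD]
    unfolding op_prod_def by simp
qed

end
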